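(* Let $G$ be a finite group, let $(K,\overline{\sigma})$ be a model of $G$-TCF and let $C=K^G=\{a\in K:\sigma_k(a)=a\text{ for all }k\}$. Then neither $K$ nor $C$ is quasi-finite (hence they are also not pseudo-finite).
   Context: $G=\{g_1,\dots,g_e\}$ is a finite group of order $e$ with neutral element $g_1=1$. $\mathcal{L}_G$ is the language of rings with $e$ additional unary function symbols $\sigma_1,\dots,\sigma_e$; write $\sigma_{g_k}=\sigma_k$ and $\overline{\sigma}=(\sigma_1,\dots,\sigma_e)$. A $G$-transformal ring (resp. field) is an $\mathcal{L}_G$-structure $(R,\overline{\sigma})$ such that $R$ is a commutative ring (resp. a field) and $g_k\mapsto\sigma_k$ is a group homomorphism $G\to\mathrm{Aut}(R)$. For a tuple $a$, $\sigma_k(a)$ is taken coordinatewise and $\overline{\sigma}(a)=(\sigma_1(a),\dots,\sigma_e(a))$. Let $G$ act on $\{1,\dots,e\}$ by $g_k\ast l=j$ iff $g_kg_l=g_j$. For $n\geq 1$ let $\mathbf{X}_i=(X_{i,1},\dots,X_{i,n})$, $i\leq e$, be $n$-tuples of variables. For a $G$-transformal field $(K,\overline{\sigma})$, the ring $K[\mathbf{X}_1,\dots,\mathbf{X}_e]$ is a $G$-transformal ring via $\sigma_{g_k}(f(\mathbf{X}_1,\dots,\mathbf{X}_e))=f^{\sigma_{g_k}}(\mathbf{X}_{g_k\ast 1},\dots,\mathbf{X}_{g_k\ast e})$, where $f^{\sigma}$ is obtained by applying $\sigma$ to the coefficients. An ideal $I$ is $G$-invariant if $\sigma_k(I)\subseteq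 I$ for all $k\leq e$. Put $V_K(I)=\{r\in K^{ne}: f(r)=0\text{ for all }f\in I\}$. A $G$-transformal field $(K,\overline{\sigma})$ is a model of $G$-TCF if for every $n\geq 1$ and all ideals $I,J$ of $K[\mathbf{X}_1,\dots,\mathbf{X}_e]$ such that $I\subsetneq J$ and $I$ is a $G$-invariant prime ideal, there is $a\in K^n$ with $\overline{\sigma}(a)\in V_K(I)\setminus V_K(J)$. A field $F$ is quasi-finite if it is perfect, for each natural number $n>0$ there is a unique extension $F\subseteq F_n$ of degree $n$ in a fixed algebraic closure $F^{\mathrm{alg}}$, and $F^{\mathrm{alg}}=\bigcup_{n>0}F_n$. Pseudo-finite fields are exactly the quasi-finite PAC fields (Ax), where a field is PAC if every absolutely irreducible variety over it has a rational point. *)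

theory Defs
  imports "HOL-Algebra.Algebra" "HOL-Computational_Algebra.Primes"
begin

section \<open>Multivariate polynomials\<close>

text \<open>
  HOL-Algebra provides polynomials in variables indexed by a set as functions from monomials
  (multisets of variables) to coefficients, with constants, addition and multiplication by a single
  variable. It lacks the full (convolution) product, the ring record, and
  evaluation at a point.
\<close>

definition (in ring) indexed_mult ::
    "('v multiset \<Rightarrow> 'a) \<Rightarrow> ('v multiset \<Rightarrow> 'a) \<Rightarrow> ('v multiset \<Rightarrow> 'a)"
  where "indexed_mult P Q = (\<lambda>m. \<Oplus>k \<in> {k. k \<subseteq># m}. P k \<otimes> Q (m - k))"

definition (in ring) mpoly_ring :: "'v set \<Rightarrow> ('v multiset \<Rightarrow> 'a) ring"
  where "mpoly_ring V =
    \<lparr> carrier = indexed_pset V (carrier R), monoid.mult = indexed_mult, monoid.one = indexed_const \<one>,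
      ring.zero = indexed_const \<zero>, add = indexed_padd \<rparr>"

definition (in ring) mpoly_eval :: "('v multiset \<Rightarrow> 'a) \<Rightarrow> ('v \<Rightarrow> 'a) \<Rightarrow> 'a"
  where "mpoly_eval P r =
    (\<Oplus>m \<in> {m. P m \<noteq> \<zero>}. P m \<otimes> (\<Otimes>v \<in> set_mset m. r v [^] count m v))"

definition (in ring) zero_locus :: "'v set \<Rightarrow> ('v multiset \<Rightarrow> 'a) set \<Rightarrow> ('v \<Rightarrow> 'a) set"
  where "zero_locus V I = {r \<in> V \<rightarrow>\<^sub>E carrier R. \<forall>f \<in> I. mpoly_eval f r = \<zero>}"


section \<open>Transformal fields\<close>

definition ring_aut_group :: "('a, 'c) ring_scheme \<Rightarrow> ('a \<Rightarrow> 'a) monoid"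
  where "ring_aut_group R =
    BijGroup (carrier R) \<lparr> carrier := ring_hom R R \<inter> Bij (carrier R) \<rparr>"

definition transformal_field ::
    "('g, 'b) monoid_scheme \<Rightarrow> ('a, 'c) ring_scheme \<Rightarrow> ('g \<Rightarrow> 'a \<Rightarrow> 'a) \<Rightarrow> bool"
  where "transformal_field G K \<sigma> \<longleftrightarrow> field K \<and> \<sigma> \<in> hom G (ring_aut_group K)"

definition fixed_field ::
    "('g, 'b) monoid_scheme \<Rightarrow> ('a, 'c) ring_scheme \<Rightarrow> ('g \<Rightarrow> 'a \<Rightarrow> 'a) \<Rightarrow> ('a, 'c) ring_scheme"
  where "fixed_field G K \<sigma> = K \<lparr> carrier := {a \<in> carrier K. \<forall>g \<in> carrier G. \<sigma> g a = a} \<rparr>"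

text \<open>
  The variables of $K[\mathbf{X}_1,\dots,\mathbf{X}_e]$ are indexed by the elements of $G$ instead of
  by their numbers in an enumeration: the variable $X_{l,i}$ is the pair $(g_l,i)$, so that
  $X_{g * l,i}$ is the pair $(g g_l, i)$.
\<close>

definition transformal_vars :: "('g, 'b) monoid_scheme \<Rightarrow> nat \<Rightarrow> ('g \<times> nat) set"
  where "transformal_vars G n = carrier G \<times> {1..n}"

text \<open>
  The action of $g$ sends a term $c \cdot m$ to $\sigma_g(c) \cdot (g * m)$. Hence the coefficient of
  $m$ in the image is $\sigma_g$ of the coefficient of $g^{-1} * m$. The guard discards monomials
  with variables outside of the carrier of $G$, on which the translation by $g^{-1}$ is meaningless.
\<close>

definition transformal_poly_map ::
    "('g, 'b) monoid_scheme \<Rightarrow> ('a, 'c) ring_scheme \<Rightarrow> ('g \<Rightarrow> 'a \<Rightarrow> 'a) \<Rightarrow> 'g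
      \<Rightarrow> (('g \<times> nat) multiset \<Rightarrow> 'a) \<Rightarrow> (('g \<times> nat) multiset \<Rightarrow> 'a)"
  where "transformal_poly_map G K \<sigma> g P = (\<lambda>m.
    if fst ` set_mset m \<subseteq> carrier G
    then \<sigma> g (P (image_mset (\<lambda>(h, i). (inv\<^bsub>G\<^esub> g \<otimes>\<^bsub>G\<^esub> h, i)) m))
    else \<zero>\<^bsub>K\<^esub>)"

definition transformal_invariant ::
    "('g, 'b) monoid_scheme \<Rightarrow> ('a, 'c) ring_scheme \<Rightarrow> ('g \<Rightarrow> 'a \<Rightarrow> 'a)
      \<Rightarrow> (('g \<times> nat) multiset \<Rightarrow> 'a) set \<Rightarrow> bool"
  where "transformal_invariant G K \<sigma> I \<longleftrightarrow>
    (\<forall>g \<in> carrier G. transformal_poly_map G K \<sigma> g ` I \<subseteq> I)"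

definition transformal_point ::
    "('g, 'b) monoid_scheme \<Rightarrow> ('g \<Rightarrow> 'a \<Rightarrow> 'a) \<Rightarrow> nat \<Rightarrow> (nat \<Rightarrow> 'a) \<Rightarrow> ('g \<times> nat \<Rightarrow> 'a)"
  where "transformal_point G \<sigma> n a = restrict (\<lambda>(g, i). \<sigma> g (a i)) (transformal_vars G n)"

definition TCF_model ::
    "('g, 'b) monoid_scheme \<Rightarrow> ('a, 'c) ring_scheme \<Rightarrow> ('g \<Rightarrow> 'a \<Rightarrow> 'a) \<Rightarrow> bool"
  where "TCF_model G K \<sigma> \<longleftrightarrow> transformal_field G K \<sigma> \<and>
    (\<forall>n \<ge> 1. \<forall>I J.
      primeideal I (ring.mpoly_ring K (transformal_vars G n)) \<and> transformal_invariant G K \<sigma> I \<and>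
      ideal J (ring.mpoly_ring K (transformal_vars G n)) \<and> I \<subset> J \<longrightarrow>
      (\<exists>a \<in> {1..n} \<rightarrow>\<^sub>E carrier K.
        transformal_point G \<sigma> n a \<in> ring.zero_locus K (transformal_vars G n) I -
                                    ring.zero_locus K (transformal_vars G n) J))"


section \<open>Quasi-finite and pseudo-finite fields\<close>

definition (in field) perfect :: bool
  where "perfect \<longleftrightarrow>
    (\<forall>p::nat. Factorial_Ring.prime p \<and> [p] \<cdot> \<one> = \<zero> \<longrightarrow>
      (\<forall>x \<in> carrier R. \<exists>y \<in> carrier R. y [^] p = x))"

text \<open>
  The fixed algebraic closure is the one from the library, in which the field is embedded via
  \<^const>\<open>ring.indexed_const\<close>.
\<close>

definition (in field) extension_of_degree :: "nat \<Rightarrow> (('a list \<times> nat) multiset \<Rightarrow> 'a) set \<Rightarrow> bool"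
  where "extension_of_degree n E \<longleftrightarrow>
    subfield E alg_closure \<and> indexed_const ` carrier R \<subseteq> E \<and>
    ring.dimension alg_closure n (indexed_const ` carrier R) E"

definition (in field) quasi_finite :: bool
  where "quasi_finite \<longleftrightarrow> perfect \<and>
    (\<forall>n > 0. \<exists>!E. extension_of_degree n E) \<and>
    carrier alg_closure = \<Union> {E. \<exists>n > 0. extension_of_degree n E}"

text \<open>
  A variety over the field is given by an ideal of polynomials over it; it is absolutely irreducible
  if this ideal generates a prime ideal of the polynomial ring over the algebraic closure.
\<close>

definition (in field) absolutely_irreducible :: "nat \<Rightarrow> (nat multiset \<Rightarrow> 'a) set \<Rightarrow> bool"
  where "absolutely_irreducible n I \<longleftrightarrow>
    ideal I (mpoly_ring {1..n}) \<and>
    (let A = ring.mpoly_ring alg_closure {1..n}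
     in primeideal (genideal A ((\<lambda>f m. indexed_const (f m)) ` I)) A)"

definition (in field) PAC :: bool
  where "PAC \<longleftrightarrow> (\<forall>n I. absolutely_irreducible n I \<longrightarrow> zero_locus {1..n} I \<noteq> {})"

text \<open>Following Ax, pseudo-finite fields are the quasi-finite PAC fields.\<close>

definition (in field) pseudo_finite :: bool
  where "pseudo_finite \<longleftrightarrow> quasi_finite \<and> PAC"

end

theory Submission
  imports Defs
begin

text \<open>
  If \<open>L\<close> is a field extension of \<open>K\<close> to which the action of \<open>G\<close> extends, and \<open>x \<in> L\<close>, then the
  kernel of \<open>X\<^sub>g \<mapsto> g x\<close> is a \<open>G\<close>-invariant prime ideal of \<open>K[X\<^sub>g : g \<in> G]\<close>. The axioms of
  \<open>G\<close>-TCF, applied with \<open>n = 1\<close> and \<open>J\<close> the whole ring, yield a root in \<open>K\<close> of every polynomial over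
  \<open>K\<close> that vanishes at \<open>x\<close>. So \<open>K\<close> has no proper algebraic extension to which the action extends.

  Let \<open>q\<close> be a prime not dividing the order of \<open>G\<close>. If \<open>E\<close> is the only extension of \<open>K\<close> of degree \<open>q\<close>
  in the algebraic closure, then every \<open>\<sigma>\<^sub>g\<close> lifts to \<open>E\<close>, and the lifts form an extension of \<open>G\<close> by
  the group \<open>Aut(E/K)\<close>, whose order is \<open>1\<close> or \<open>q\<close>. This extension splits by averaging cocycles, so the
  action of \<open>G\<close> extends to \<open>E\<close>. If \<open>f\<close> is an irreducible polynomial of degree \<open>q\<close> over the fixed
  field, then taking norms shows that \<open>f\<close> stays irreducible over \<open>K\<close>, and \<open>G\<close> acts on
  \<open>K[X]/(f)\<close> through the coefficients. Both conclusions are impossible.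
\<close>

section \<open>The ring of multivariate polynomials\<close>

text \<open>Lifts of the \<sigma>_g to E are determined only up to Aut(E/K), so chosen lifts compose
  correctly only up to a factor set. Its class in the second cohomology of G is the obstruction to
  an action on E, and q is taken prime to the order of G because the class is then trivial.
  Uniqueness of E keeps the lifts inside E: a lift carries E to a field generated by a conjugate
  root, again of degree q. For the fixed field C this obstruction does not arise, since G can be
  made to fix a root of a polynomial with coefficients in C. The price is that the polynomial has to
  be irreducible over K, and this is where the choice of q enters a second time. An algebraic
  closure contains only a copy of its base field, so actions and polynomials are carried along an
  embedding throughout.\<close>

lemma double_diff_mset: "k \<subseteq># m \<Longrightarrow> m - (m - k) = k"
  by (intro multiset_eqI) (simp add: mset_subset_eq_count)

text \<open>The convolution sum in \<open>indexed_mult\<close> ranges over this set, and a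
  \<open>finsum\<close> over an infinite set would silently take the value zero.\<close>

lemma finite_submultisets: "finite {k. k \<subseteq># m}"
proof (induction m)
  case empty
  then show ?case by simp
next
  case (add x m)
  have "{k. k \<subseteq># add_mset x m} \<subseteq> {k. k \<subseteq># m} \<union> add_mset x ` {k. k \<subseteq># m}"
  proof
    fix k assume k: "k \<in> {k. k \<subseteq># add_mset x m}"
    show "k \<in> {k. k \<subseteq># m} \<union> add_mset x ` {k. k \<subseteq># m}"
    proof (cases "x \<in># k")
      case True
      then obtain k' where "k = add_mset x k'" by (metis insert_DiffM)
      with k show ?thesis by auto
    next
      case False
      have "count k y \<le> count m y" for y
        using k False mset_subset_eq_count[of k "add_mset x m" y]
        by (cases "y = x") (auto simp: not_in_iff)
      then show ?thesis by (auto intro: mset_subset_eqI)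
    qed
  qed
  then show ?case using add.IH finite_subset by blast
qed

context ring
begin

text \<open>\<open>indexed_pset\<close> is generated inductively from constants by sums and by
  multiplication with a variable. The familiar description by finite support and variables from V
  has to be recovered by induction; it makes the sum in \<open>mpoly_eval\<close> finite.\<close>

lemma indexed_pset_support:
  assumes "P \<in> indexed_pset V S" and "S \<subseteq> carrier R"
  shows "finite {m. P m \<noteq> \<zero>}" and "P m \<noteq> \<zero> \<Longrightarrow> set_mset m \<subseteq> V"
proof -
  have "finite {m. P m \<noteq> \<zero>} \<and> (\<forall>m. P m \<noteq> \<zero> \<longrightarrow> set_mset m \<subseteq> V)"
    using assms(1)
  proof induction
    case (indexed_const k)
    have "{m. indexed_const k m \<noteq> \<zero>} \<subseteq> {{#}}"
      by (auto simp: indexed_const_def)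
    then show ?case
      by (auto simp: indexed_const_def intro: finite_subset)
  next
    case (indexed_padd P Q)
    have "{m. indexed_padd P Q m \<noteq> \<zero>} \<subseteq> {m. P m \<noteq> \<zero>} \<union> {m. Q m \<noteq> \<zero>}"
      by (auto simp: indexed_padd_def)
    then show ?case
      using indexed_padd.IH by (auto intro: finite_subset)
  next
    case (indexed_pmult P i)
    have "{m. indexed_pmult P i m \<noteq> \<zero>} \<subseteq> add_mset i ` {m. P m \<noteq> \<zero>}"
    proof
      fix m assume "m \<in> {m. indexed_pmult P i m \<noteq> \<zero>}"
      then have "i \<in># m" "P (m - {#i#}) \<noteq> \<zero>"
        by (auto simp: indexed_pmult_def split: if_splits)
      then show "m \<in> add_mset i ` {m. P m \<noteq> \<zero>}"
        by (intro image_eqI[of _ _ "m - {#i#}"]) auto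
    qed
    then have "finite {m. indexed_pmult P i m \<noteq> \<zero>}"
      using indexed_pmult.IH finite_subset by blast
    moreover have "set_mset m \<subseteq> V" if "indexed_pmult P i m \<noteq> \<zero>" for m
    proof -
      from that have "i \<in># m" "P (m - {#i#}) \<noteq> \<zero>"
        by (auto simp: indexed_pmult_def split: if_splits)
      then have "set_mset (m - {#i#}) \<subseteq> V" using indexed_pmult.IH by blast
      then have "set_mset (add_mset i (m - {#i#})) \<subseteq> V" using indexed_pmult.hyps(2) by simp
      then show ?thesis using \<open>i \<in># m\<close> by simp
    qed
    ultimately show ?case by blast
  qed
  then show "finite {m. P m \<noteq> \<zero>}" "P m \<noteq> \<zero> \<Longrightarrow> set_mset m \<subseteq> V"
    by auto
qed

lemma indexed_mult_closed_coeff: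
  assumes "carrier_coeff P" "carrier_coeff Q"
  shows "carrier_coeff (indexed_mult P Q)"
  using assms by (auto simp: carrier_coeff_def indexed_mult_def intro!: finsum_closed)

text \<open>This and the next two lemmas compute a product whose right factor is built by one of the
  three generating rules of \<open>indexed_pset\<close>. Closure, associativity and multiplicativity
  of evaluation then follow by induction on the right factor, without double sums.\<close>

lemma indexed_mult_const:
  assumes "carrier_coeff P" "c \<in> carrier R"
  shows "indexed_mult P (indexed_const c) = (\<lambda>m. P m \<otimes> c)"
proof
  fix m
  have "indexed_mult P (indexed_const c) m = (\<Oplus>k\<in>{m}. P k \<otimes> c)"
    unfolding indexed_mult_def
    using assms
    by (intro add.finprod_mono_neutral_cong_right)
       (auto simp: finite_submultisets indexed_const_def carrier_coeff_def Diff_eq_empty_iff_mset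
             intro: subset_mset.antisym)
  then show "indexed_mult P (indexed_const c) m = P m \<otimes> c"
    using assms by (simp add: carrier_coeff_def)
qed

lemma indexed_mult_padd:
  assumes "carrier_coeff P" "carrier_coeff Q" "carrier_coeff Q'"
  shows "indexed_mult P (indexed_padd Q Q') = indexed_padd (indexed_mult P Q) (indexed_mult P Q')"
proof
  fix m
  have "indexed_mult P (indexed_padd Q Q') m =
      (\<Oplus>k\<in>{k. k \<subseteq># m}. P k \<otimes> Q (m - k) \<oplus> P k \<otimes> Q' (m - k))"
    using assms unfolding indexed_mult_def indexed_padd_def carrier_coeff_def
    by (intro finsum_cong') (auto simp: r_distr)
  also have "\<dots> = indexed_padd (indexed_mult P Q) (indexed_mult P Q') m"
    using assms unfolding indexed_mult_def indexed_padd_def carrier_coeff_def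
    by (intro finsum_addf) auto
  finally show "indexed_mult P (indexed_padd Q Q') m =
    indexed_padd (indexed_mult P Q) (indexed_mult P Q') m" .
qed

lemma indexed_mult_pmult:
  assumes "carrier_coeff P" "carrier_coeff Q"
  shows "indexed_mult P (indexed_pmult Q i) = indexed_pmult (indexed_mult P Q) i"
proof
  fix m
  show "indexed_mult P (indexed_pmult Q i) m = indexed_pmult (indexed_mult P Q) i m"
  proof (cases "i \<in># m")
    case False
    have "indexed_mult P (indexed_pmult Q i) m = (\<Oplus>k\<in>{k. k \<subseteq># m}. \<zero>)"
      using assms False unfolding indexed_mult_def indexed_pmult_def carrier_coeff_def
      by (intro finsum_cong') (auto dest: in_diffD)
    then show ?thesis
      using False by (simp add: indexed_pmult_def)
  next
    case True
    then obtain m' where m: "m = add_mset i m'" by (metis insert_DiffM)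
    \<comment> \<open>A submultiset of m that is not one of m' uses every copy of i, so its
      complement in m has no i and its term vanishes. The other terms are exactly those of the
      product at m'.\<close>
    have *: "i \<notin># add_mset i m' - k" if "k \<subseteq># add_mset i m'" "\<not> k \<subseteq># m'" for k
    proof
      assume "i \<in># add_mset i m' - k"
      then obtain l where l: "add_mset i m' - k = add_mset i l" by (metis insert_DiffM)
      then have "add_mset i m' = k + add_mset i l" using that(1)
        by (metis subset_mset.add_diff_inverse)
      then have "m' = k + l" by simp
      with that(2) show False by simp
    qed
    have **: "add_mset i m' - k = add_mset i (m' - k)" if "k \<subseteq># m'" for k
      using that by (intro multiset_eqI) (auto simp: Suc_diff_le mset_subset_eq_count)
    have "indexed_mult P (indexed_pmult Q i) m = (\<Oplus>k\<in>{k. k \<subseteq># m'}. P k \<otimes> Q (m' - k))"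
      using assms * ** unfolding indexed_mult_def indexed_pmult_def carrier_coeff_def m
      by (intro add.finprod_mono_neutral_cong_right)
         (auto simp: finite_submultisets intro: subset_mset.order_trans)
    then show ?thesis
      by (simp add: m indexed_pmult_def indexed_mult_def)
  qed
qed

lemma pset_coeff: "P \<in> indexed_pset V (carrier R) \<Longrightarrow> carrier_coeff P"
  using indexed_pset_in_carrier by blast

end

context cring
begin

text \<open>The map k to m - k is an involution on the submultisets of m and exchanges the two
  factors. Through it, the rules for the right factor also serve the left one.\<close>

lemma indexed_mult_comm:
  fixes P Q :: "'v multiset \<Rightarrow> 'a"
  assumes "carrier_coeff P" "carrier_coeff Q"
  shows "indexed_mult P Q = indexed_mult Q P"
proof
  fix m :: "'v multiset"
  let ?S = "{k. k \<subseteq># m}"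
  have inj: "inj_on (\<lambda>k. m - k) ?S"
    by (rule inj_on_inverseI[of _ "\<lambda>k. m - k"]) (simp add: double_diff_mset)
  have img: "(\<lambda>k. m - k) ` ?S = ?S"
  proof -
    have "k \<in> (\<lambda>k. m - k) ` ?S" if "k \<subseteq># m" for k
      using that by (intro image_eqI[of _ _ "m - k"]) (simp_all add: double_diff_mset)
    then show ?thesis by auto
  qed
  have "indexed_mult P Q m = (\<Oplus>k\<in>(\<lambda>k. m - k) ` ?S. P k \<otimes> Q (m - k))"
    unfolding img by (simp add: indexed_mult_def)
  also have "\<dots> = (\<Oplus>k\<in>?S. P (m - k) \<otimes> Q (m - (m - k)))"
    using assms by (intro finsum_reindex inj) (auto simp: carrier_coeff_def)
  also have "\<dots> = (\<Oplus>k\<in>?S. Q k \<otimes> P (m - k))"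
    using assms by (intro finsum_cong') (auto simp: carrier_coeff_def double_diff_mset m_comm)
  finally show "indexed_mult P Q m = indexed_mult Q P m"
    by (simp add: indexed_mult_def)
qed

lemma indexed_mult_closed:
  fixes P Q :: "'v multiset \<Rightarrow> 'a"
  assumes "P \<in> indexed_pset V (carrier R)" "Q \<in> indexed_pset V (carrier R)"
  shows "indexed_mult P Q \<in> indexed_pset V (carrier R)"
  using assms(2)
proof induction
  case (indexed_const c)
  have "(\<lambda>m. P m \<otimes> c) \<in> indexed_pset V (carrier R)"
    using assms(1)
  proof induction
    case (indexed_const k)
    have "(\<lambda>m. indexed_const k m \<otimes> c) = (indexed_const (k \<otimes> c) :: 'v multiset \<Rightarrow> 'a)"
      using \<open>c \<in> carrier R\<close> by (auto simp: indexed_const_def)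
    then show ?case
      using indexed_const \<open>c \<in> carrier R\<close> by (simp add: indexed_pset.indexed_const)
  next
    case (indexed_padd P Q)
    have "(\<lambda>m. indexed_padd P Q m \<otimes> c) = indexed_padd (\<lambda>m. P m \<otimes> c) (\<lambda>m. Q m \<otimes> c)"
      using \<open>c \<in> carrier R\<close> indexed_padd.hyps[THEN pset_coeff]
      by (auto simp: indexed_padd_def carrier_coeff_def l_distr)
    then show ?case
      using indexed_padd by (auto intro: indexed_pset.indexed_padd)
  next
    case (indexed_pmult P i)
    have "(\<lambda>m. indexed_pmult P i m \<otimes> c) = indexed_pmult (\<lambda>m. P m \<otimes> c) i"
      using \<open>c \<in> carrier R\<close> by (auto simp: indexed_pmult_def)
    then show ?case
      using indexed_pmult by (auto intro: indexed_pset.indexed_pmult)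
  qed
  then show ?case
    using assms(1) indexed_const by (simp add: indexed_mult_const pset_coeff)
next
  case (indexed_padd Q Q')
  then show ?case
    using assms(1) by (auto simp: indexed_mult_padd pset_coeff intro: indexed_pset.indexed_padd)
next
  case (indexed_pmult Q i)
  then show ?case
    using assms(1) by (auto simp: indexed_mult_pmult pset_coeff intro: indexed_pset.indexed_pmult)
qed

lemma indexed_mult_assoc:
  fixes P Q T :: "'v multiset \<Rightarrow> 'a"
  assumes "P \<in> indexed_pset V (carrier R)" "Q \<in> indexed_pset V (carrier R)"
    "T \<in> indexed_pset V (carrier R)"
  shows "indexed_mult (indexed_mult P Q) T = indexed_mult P (indexed_mult Q T)"
  using assms(3)
proof induction
  case (indexed_const c)
  have P: "carrier_coeff P" and Q: "carrier_coeff Q"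
    using assms pset_coeff by blast+
  have "indexed_mult P Q m \<otimes> c = indexed_mult P (\<lambda>m. Q m \<otimes> c) m"
    for m :: "'v multiset"
    unfolding indexed_mult_def using indexed_const P Q
    by (subst finsum_ldistr)
       (auto simp: finite_submultisets carrier_coeff_def m_assoc intro!: finsum_cong')
  then show ?case
    using P Q indexed_const by (simp add: indexed_mult_const indexed_mult_closed_coeff)
next
  case (indexed_padd T T')
  then show ?case
    using assms(1,2) by (simp add: indexed_mult_padd indexed_mult_closed_coeff pset_coeff)
next
  case (indexed_pmult T i)
  then show ?case
    using assms(1,2) by (simp add: indexed_mult_pmult indexed_mult_closed_coeff pset_coeff)
qed

lemma mpoly_ring_is_cring: "cring (mpoly_ring V)"
proof (rule cringI)
  let ?M = "indexed_pset V (carrier R)"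
  show "abelian_group (mpoly_ring V)"
  proof (rule abelian_groupI)
    fix P assume "P \<in> carrier (mpoly_ring V)"
    then have P: "P \<in> ?M" by (simp add: mpoly_ring_def)
    \<comment> \<open>The additive inverse is taken as the product with the constant -1, so its
      membership in the inductive set follows from closure under products.\<close>
    have "indexed_mult P (indexed_const (\<ominus> \<one>)) \<in> ?M"
      using P by (intro indexed_mult_closed indexed_pset.indexed_const) auto
    moreover have "indexed_padd (indexed_mult P (indexed_const (\<ominus> \<one>))) P = indexed_const \<zero>"
      using P[THEN pset_coeff]
      by (subst indexed_mult_const)
         (auto simp: indexed_padd_def indexed_zero_def carrier_coeff_def r_minus l_neg)
    ultimately show "\<exists>y\<in>carrier (mpoly_ring V). y \<oplus>\<^bsub>mpoly_ring V\<^esub> P = \<zero>\<^bsub>mpoly_ring V\<^esub>"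
      by (auto simp: mpoly_ring_def)
  qed (auto simp: mpoly_ring_def indexed_padd_zero pset_coeff
        intro: indexed_pset.indexed_padd indexed_pset.indexed_const,
       auto simp: indexed_padd_def carrier_coeff_def dest!: pset_coeff intro!: a_assoc a_comm)
  show "comm_monoid (mpoly_ring V)"
  proof (rule comm_monoidI)
    fix P assume "P \<in> carrier (mpoly_ring V)"
    then have P: "carrier_coeff P" by (simp add: mpoly_ring_def pset_coeff)
    have "carrier_coeff (indexed_const \<one>)" by (auto simp: carrier_coeff_def indexed_const_def)
    then have "indexed_mult (indexed_const \<one>) P = indexed_mult P (indexed_const \<one>)"
      using P indexed_mult_comm by blast
    also have "\<dots> = P"
      using P by (simp add: indexed_mult_const) (simp add: carrier_coeff_def)
    finally show "\<one>\<^bsub>mpoly_ring V\<^esub> \<otimes>\<^bsub>mpoly_ring V\<^esub> P = P"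
      by (simp add: mpoly_ring_def)
  qed (auto simp: mpoly_ring_def indexed_mult_assoc indexed_mult_closed
        intro: indexed_pset.indexed_const indexed_mult_comm pset_coeff)
  fix P Q T
  assume "P \<in> carrier (mpoly_ring V)" "Q \<in> carrier (mpoly_ring V)" "T \<in> carrier (mpoly_ring V)"
  then have "carrier_coeff P" "carrier_coeff Q" "carrier_coeff T"
    by (simp_all add: mpoly_ring_def pset_coeff)
  then show "(P \<oplus>\<^bsub>mpoly_ring V\<^esub> Q) \<otimes>\<^bsub>mpoly_ring V\<^esub> T =
      P \<otimes>\<^bsub>mpoly_ring V\<^esub> T \<oplus>\<^bsub>mpoly_ring V\<^esub> Q \<otimes>\<^bsub>mpoly_ring V\<^esub> T"
    by (simp add: mpoly_ring_def indexed_mult_comm[of _ T] indexed_padd_in_carrier indexed_mult_padd)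
qed

end

section \<open>Evaluation homomorphisms\<close>

context cring
begin

definition monomial_value :: "('v \<Rightarrow> 'a) \<Rightarrow> 'v multiset \<Rightarrow> 'a"
  where "monomial_value r m = (\<Otimes>v\<in>set_mset m. r v [^] count m v)"

lemma monomial_value_closed:
  "r \<in> set_mset m \<rightarrow> carrier R \<Longrightarrow> monomial_value r m \<in> carrier R"
  unfolding monomial_value_def by (intro finprod_closed) auto

lemma monomial_value_add_mset:
  assumes "r \<in> set_mset (add_mset i m) \<rightarrow> carrier R"
  shows "monomial_value r (add_mset i m) = r i \<otimes> monomial_value r m"
proof -
  let ?f = "\<lambda>v. r v [^] count m v"
  have i: "r i \<in> carrier R" and f: "?f \<in> set_mset (add_mset i m) \<rightarrow> carrier R"
    using assms by auto
  have f': "?f \<in> set_mset m - {i} \<rightarrow> carrier R" using f by auto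
  have "monomial_value r (add_mset i m) =
      (\<Otimes>v\<in>insert i (set_mset m - {i}). r v [^] count (add_mset i m) v)"
    unfolding monomial_value_def by (intro finprod_cong') (use assms in auto)
  also have "\<dots> = r i [^] Suc (count m i) \<otimes>
      (\<Otimes>v\<in>set_mset m - {i}. r v [^] count (add_mset i m) v)"
    using assms by (subst finprod_insert) auto
  also have "(\<Otimes>v\<in>set_mset m - {i}. r v [^] count (add_mset i m) v) = (\<Otimes>v\<in>set_mset m - {i}. ?f v)"
    using f' by (intro finprod_cong') auto
  also have "r i [^] Suc (count m i) \<otimes> (\<Otimes>v\<in>set_mset m - {i}. ?f v) =
      r i \<otimes> (?f i \<otimes> (\<Otimes>v\<in>set_mset m - {i}. ?f v))"
    using i f' by (simp add: m_ac finprod_closed)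
  also have "?f i \<otimes> (\<Otimes>v\<in>set_mset m - {i}. ?f v) = (\<Otimes>v\<in>insert i (set_mset m - {i}). ?f v)"
    using i f' by (subst finprod_insert) auto
  also have "\<dots> = monomial_value r m"
    unfolding monomial_value_def
    by (intro finprod_mono_neutral_cong_right) (use i f in \<open>auto simp: not_in_iff\<close>)
  finally show ?thesis .
qed

text \<open>\<open>mpoly_eval\<close> sums over the exact support, which may shrink under addition.
  Passing to any finite superset lets several polynomials be summed over a common set.\<close>

lemma mpoly_eval_eq_finsum:
  assumes "finite A" "{m. P m \<noteq> \<zero>} \<subseteq> A" "carrier_coeff P"
    and "\<And>m. m \<in> A \<Longrightarrow> monomial_value r m \<in> carrier R"
  shows "mpoly_eval P r = (\<Oplus>m\<in>A. P m \<otimes> monomial_value r m)"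
  unfolding mpoly_eval_def monomial_value_def[symmetric] using assms
  by (intro add.finprod_mono_neutral_cong_left) (auto simp: carrier_coeff_def)

lemma mpoly_eval_const:
  assumes "c \<in> carrier R"
  shows "mpoly_eval (indexed_const c) r = c"
proof -
  have "mpoly_eval (indexed_const c) r = (\<Oplus>m\<in>{{#}}. indexed_const c m \<otimes> monomial_value r m)"
    using assms
    by (intro mpoly_eval_eq_finsum) (auto simp: indexed_const_def carrier_coeff_def monomial_value_def)
  then show ?thesis
    using assms by (simp add: indexed_const_def monomial_value_def)
qed

context
  fixes V :: "'v set" and r :: "'v \<Rightarrow> 'a"
  assumes r: "r \<in> V \<rightarrow> carrier R"
begin

lemma monomial_value_closed': "set_mset m \<subseteq> V \<Longrightarrow> monomial_value r m \<in> carrier R"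
  using r by (intro monomial_value_closed) auto

lemma mpoly_eval_closed:
  assumes "P \<in> indexed_pset V (carrier R)"
  shows "mpoly_eval P r \<in> carrier R"
  unfolding mpoly_eval_def monomial_value_def[symmetric]
  using indexed_pset_support(2)[OF assms order_refl] pset_coeff[OF assms] monomial_value_closed'
  by (intro finsum_closed) (auto simp: carrier_coeff_def)

lemma mpoly_eval_padd:
  assumes P: "P \<in> indexed_pset V (carrier R)" and Q: "Q \<in> indexed_pset V (carrier R)"
  shows "mpoly_eval (indexed_padd P Q) r = mpoly_eval P r \<oplus> mpoly_eval Q r"
proof -
  let ?A = "{m. P m \<noteq> \<zero>} \<union> {m. Q m \<noteq> \<zero>}"
  note supp = indexed_pset_support[OF P order_refl] indexed_pset_support[OF Q order_refl]
  note coeff = pset_coeff[OF P] pset_coeff[OF Q]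
  have fin: "finite ?A" using supp by auto
  have mv: "monomial_value r m \<in> carrier R" if "m \<in> ?A" for m
    using that supp monomial_value_closed' by auto
  have "mpoly_eval (indexed_padd P Q) r = (\<Oplus>m\<in>?A. indexed_padd P Q m \<otimes> monomial_value r m)"
    using fin mv coeff by (intro mpoly_eval_eq_finsum indexed_padd_in_carrier) (auto simp: indexed_padd_def)
  also have "\<dots> = (\<Oplus>m\<in>?A. P m \<otimes> monomial_value r m \<oplus> Q m \<otimes> monomial_value r m)"
    using mv coeff by (intro finsum_cong') (auto simp: indexed_padd_def carrier_coeff_def l_distr)
  also have "\<dots> = (\<Oplus>m\<in>?A. P m \<otimes> monomial_value r m) \<oplus> (\<Oplus>m\<in>?A. Q m \<otimes> monomial_value r m)"
    using mv coeff by (intro finsum_addf) (auto simp: carrier_coeff_def)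
  also have "\<dots> = mpoly_eval P r \<oplus> mpoly_eval Q r"
    using fin mv coeff by (subst (1 2) mpoly_eval_eq_finsum[where A = ?A]) auto
  finally show ?thesis .
qed

lemma mpoly_eval_pmult:
  assumes P: "P \<in> indexed_pset V (carrier R)" and i: "i \<in> V"
  shows "mpoly_eval (indexed_pmult P i) r = mpoly_eval P r \<otimes> r i"
proof -
  let ?A = "{m. P m \<noteq> \<zero>}"
  note supp = indexed_pset_support[OF P order_refl]
  note coeff = pset_coeff[OF P]
  have ri: "r i \<in> carrier R" using r i by auto
  have mv: "monomial_value r m \<in> carrier R" if "m \<in> ?A" for m
    using that supp monomial_value_closed' by auto
  have mv': "monomial_value r (add_mset i m) = r i \<otimes> monomial_value r m" if "m \<in> ?A" for m
    using r i supp(2)[of m] that by (intro monomial_value_add_mset) auto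
  have supp': "{m. indexed_pmult P i m \<noteq> \<zero>} \<subseteq> add_mset i ` ?A"
  proof
    fix m assume "m \<in> {m. indexed_pmult P i m \<noteq> \<zero>}"
    then have "i \<in># m" "P (m - {#i#}) \<noteq> \<zero>"
      by (auto simp: indexed_pmult_def split: if_splits)
    then show "m \<in> add_mset i ` ?A"
      by (intro image_eqI[of _ _ "m - {#i#}"]) auto
  qed
  have "mpoly_eval (indexed_pmult P i) r =
      (\<Oplus>m\<in>add_mset i ` ?A. indexed_pmult P i m \<otimes> monomial_value r m)"
    using supp(1) mv mv' coeff supp' ri
    by (intro mpoly_eval_eq_finsum indexed_pmult_in_carrier) auto
  also have "\<dots> = (\<Oplus>m\<in>?A. indexed_pmult P i (add_mset i m) \<otimes> monomial_value r (add_mset i m))"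
    using coeff mv mv' ri
    by (intro finsum_reindex) (auto simp: indexed_pmult_def carrier_coeff_def inj_on_def)
  also have "\<dots> = (\<Oplus>m\<in>?A. (P m \<otimes> monomial_value r m) \<otimes> r i)"
    using coeff mv mv' ri
    by (intro finsum_cong') (auto simp: indexed_pmult_def carrier_coeff_def m_ac)
  also have "\<dots> = (\<Oplus>m\<in>?A. P m \<otimes> monomial_value r m) \<otimes> r i"
    using coeff mv ri supp by (intro finsum_ldistr[symmetric]) (auto simp: carrier_coeff_def)
  also have "(\<Oplus>m\<in>?A. P m \<otimes> monomial_value r m) = mpoly_eval P r"
    using supp mv coeff by (intro mpoly_eval_eq_finsum[symmetric]) auto
  finally show ?thesis .
qed

lemma mpoly_eval_mult:
  assumes P: "P \<in> indexed_pset V (carrier R)" and Q: "Q \<in> indexed_pset V (carrier R)"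
  shows "mpoly_eval (indexed_mult P Q) r = mpoly_eval P r \<otimes> mpoly_eval Q r"
  using Q
proof induction
  case (indexed_const c)
  have "mpoly_eval (\<lambda>m. P m \<otimes> c) r = mpoly_eval P r \<otimes> c"
  proof -
    have "mpoly_eval (\<lambda>m. P m \<otimes> c) r = (\<Oplus>m\<in>{m. P m \<noteq> \<zero>}. P m \<otimes> c \<otimes> monomial_value r m)"
      using indexed_pset_support[OF P order_refl] pset_coeff[OF P] monomial_value_closed' indexed_const
      by (intro mpoly_eval_eq_finsum) (auto simp: carrier_coeff_def)
    also have "\<dots> = (\<Oplus>m\<in>{m. P m \<noteq> \<zero>}. (P m \<otimes> monomial_value r m) \<otimes> c)"
      using indexed_pset_support[OF P order_refl] pset_coeff[OF P] monomial_value_closed' indexed_const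
      by (intro finsum_cong') (auto simp: carrier_coeff_def m_ac)
    also have "\<dots> = (\<Oplus>m\<in>{m. P m \<noteq> \<zero>}. P m \<otimes> monomial_value r m) \<otimes> c"
      using indexed_pset_support[OF P order_refl] pset_coeff[OF P] monomial_value_closed' indexed_const
      by (intro finsum_ldistr[symmetric]) (auto simp: carrier_coeff_def)
    finally show ?thesis by (simp add: mpoly_eval_def monomial_value_def)
  qed
  then show ?case
    using P indexed_const by (simp add: indexed_mult_const pset_coeff mpoly_eval_const)
next
  case (indexed_padd Q T)
  then show ?case
    using P by (simp add: indexed_mult_padd pset_coeff mpoly_eval_padd indexed_mult_closed
        mpoly_eval_closed r_distr)
next
  case (indexed_pmult Q i)
  moreover have "r i \<in> carrier R" using r indexed_pmult by auto
  ultimately show ?case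
    using P by (simp add: indexed_mult_pmult pset_coeff mpoly_eval_pmult indexed_mult_closed
        mpoly_eval_closed m_assoc)
qed

end

end

section \<open>Polynomials under a change of coefficients\<close>

context ring_hom_cring
begin

lemma map_indexed_const: "(\<lambda>m. h (R.indexed_const c m)) = S.indexed_const (h c)"
  by (auto simp: R.indexed_const_def S.indexed_const_def)

lemma map_indexed_padd:
  assumes "R.carrier_coeff P" "R.carrier_coeff Q"
  shows "(\<lambda>m. h (R.indexed_padd P Q m)) = S.indexed_padd (\<lambda>m. h (P m)) (\<lambda>m. h (Q m))"
  using assms by (auto simp: R.indexed_padd_def S.indexed_padd_def R.carrier_coeff_def)

lemma map_indexed_pmult:
  "(\<lambda>m. h (R.indexed_pmult P i m)) = S.indexed_pmult (\<lambda>m. h (P m)) i"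
  by (auto simp: R.indexed_pmult_def S.indexed_pmult_def)

lemma map_indexed_mult:
  assumes "R.carrier_coeff P" "R.carrier_coeff Q"
  shows "(\<lambda>m. h (R.indexed_mult P Q m)) = S.indexed_mult (\<lambda>m. h (P m)) (\<lambda>m. h (Q m))"
proof
  fix m
  have "h (\<Oplus>k\<in>{k. k \<subseteq># m}. P k \<otimes> Q (m - k)) =
      (\<Oplus>\<^bsub>S\<^esub>k\<in>{k. k \<subseteq># m}. (h \<circ> (\<lambda>k. P k \<otimes> Q (m - k))) k)"
    using assms by (subst hom_finsum) (auto simp: R.carrier_coeff_def o_def)
  also have "\<dots> = (\<Oplus>\<^bsub>S\<^esub>k\<in>{k. k \<subseteq># m}. h (P k) \<otimes>\<^bsub>S\<^esub> h (Q (m - k)))"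
    using assms by (intro S.finsum_cong') (auto simp: R.carrier_coeff_def)
  finally show "h (R.indexed_mult P Q m) = S.indexed_mult (\<lambda>m. h (P m)) (\<lambda>m. h (Q m)) m"
    by (simp add: R.indexed_mult_def S.indexed_mult_def)
qed

lemma map_indexed_pset:
  assumes "P \<in> R.indexed_pset V (carrier R)"
  shows "(\<lambda>m. h (P m)) \<in> S.indexed_pset V (carrier S)"
  using assms
proof induction
  case (indexed_const k)
  then show ?case by (simp add: map_indexed_const S.indexed_pset.indexed_const)
next
  case (indexed_padd P Q)
  then show ?case by (simp add: map_indexed_padd R.pset_coeff S.indexed_pset.indexed_padd)
next
  case (indexed_pmult P i)
  then show ?case by (simp add: map_indexed_pmult S.indexed_pset.indexed_pmult)
qed

text \<open>With S an extension field and h the embedding, the kernel of this map is the prime ideal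
  to which the axioms are applied.\<close>

lemma mpoly_eval_is_hom:
  assumes "r \<in> V \<rightarrow> carrier S"
  shows "(\<lambda>P. S.mpoly_eval (\<lambda>m. h (P m)) r) \<in> ring_hom (R.mpoly_ring V) S"
  using assms
  by (intro ring_hom_memI)
     (simp_all add: R.mpoly_ring_def R.pset_coeff map_indexed_padd map_indexed_mult
        map_indexed_const map_indexed_pset
        S.mpoly_eval_closed S.mpoly_eval_mult S.mpoly_eval_padd S.mpoly_eval_const)

text \<open>A one-variable polynomial is a coefficient list. Applying \<open>eval\<close> inside the
  polynomial ring, with the variable v as argument, turns it into p(X_v), and its value at a point
  follows from the homomorphism property.\<close>

lemma mpoly_eval_univariate:
  assumes "r \<in> V \<rightarrow> carrier S" "v \<in> V" "set p \<subseteq> carrier R"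
  defines "P \<equiv> ring.eval (R.mpoly_ring V) (map R.indexed_const p) (R.indexed_var v)"
  shows "P \<in> carrier (R.mpoly_ring V)"
    and "S.mpoly_eval (\<lambda>m. h (P m)) r = S.eval (map h p) (r v)"
proof -
  interpret M: cring "R.mpoly_ring V" by (rule R.mpoly_ring_is_cring)
  interpret E: ring_hom_ring "R.mpoly_ring V" S "\<lambda>P. S.mpoly_eval (\<lambda>m. h (P m)) r"
    using mpoly_eval_is_hom[OF assms(1)] M.ring_axioms S.ring_axioms by (simp add: ring_hom_ringI2)
  have const: "set (map R.indexed_const p) \<subseteq> carrier (R.mpoly_ring V)"
    using assms(3) by (auto simp: R.mpoly_ring_def intro: R.indexed_pset.indexed_const)
  have var: "R.indexed_var v \<in> carrier (R.mpoly_ring V)"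
    using assms(2)
    by (auto simp: R.mpoly_ring_def R.indexed_var_def
        intro: R.indexed_pset.indexed_const R.indexed_pset.indexed_pmult)
  show "P \<in> carrier (R.mpoly_ring V)"
    unfolding P_def using const var by (intro M.eval_in_carrier)
  have "r v \<in> carrier S" using assms by auto
  then have "S.mpoly_eval (\<lambda>m. h (R.indexed_var v m)) r = r v"
    unfolding R.indexed_var_def map_indexed_pmult map_indexed_const using assms
    by (subst S.mpoly_eval_pmult[where V = V])
       (auto simp: S.mpoly_eval_const intro: S.indexed_pset.indexed_const)
  moreover have "map (\<lambda>P. S.mpoly_eval (\<lambda>m. h (P m)) r) (map R.indexed_const p) = map h p"
    using assms(3) by (auto simp: map_indexed_const S.mpoly_eval_const)
  ultimately show "S.mpoly_eval (\<lambda>m. h (P m)) r = S.eval (map h p) (r v)"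
    unfolding P_def using E.eval_hom'[OF var const] by (simp del: map_map)
qed

end

section \<open>Solving polynomial equations in models\<close>

lemma (in ring) carrier_mpoly_ring: "carrier (mpoly_ring V) = indexed_pset V (carrier R)"
  by (simp add: mpoly_ring_def)

locale transformal = G: group G + K: field K
  for G :: "('g, 'b) monoid_scheme" and K :: "('a, 'c) ring_scheme" +
  fixes \<sigma> :: "'g \<Rightarrow> 'a \<Rightarrow> 'a"
  assumes \<sigma>_hom: "\<sigma> \<in> hom G (ring_aut_group K)"
begin

lemma \<sigma>_ring_hom: "g \<in> carrier G \<Longrightarrow> \<sigma> g \<in> ring_hom K K"
  using \<sigma>_hom by (auto simp: hom_def ring_aut_group_def)

lemma \<sigma>_bij: "g \<in> carrier G \<Longrightarrow> bij_betw (\<sigma> g) (carrier K) (carrier K)"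
  using \<sigma>_hom by (auto simp: hom_def ring_aut_group_def Bij_def)

lemma \<sigma>_closed: "g \<in> carrier G \<Longrightarrow> a \<in> carrier K \<Longrightarrow> \<sigma> g a \<in> carrier K"
  using \<sigma>_ring_hom ring_hom_closed by metis

lemma \<sigma>_mult:
  assumes "g \<in> carrier G" "g' \<in> carrier G" "a \<in> carrier K"
  shows "\<sigma> (g \<otimes>\<^bsub>G\<^esub> g') a = \<sigma> g (\<sigma> g' a)"
proof -
  have "\<sigma> g \<in> Bij (carrier K)" "\<sigma> g' \<in> Bij (carrier K)"
    using \<sigma>_hom assms by (auto simp: hom_def ring_aut_group_def)
  moreover have "\<sigma> (g \<otimes>\<^bsub>G\<^esub> g') = \<sigma> g \<otimes>\<^bsub>BijGroup (carrier K)\<^esub> \<sigma> g'"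
    using \<sigma>_hom assms by (simp add: hom_def ring_aut_group_def)
  ultimately show ?thesis using assms by (simp add: BijGroup_def compose_def)
qed

text \<open>Multiplicativity makes this map idempotent, and an injective idempotent map is the
  identity. The argument avoids the group structure of \<open>ring_aut_group\<close>, which is
  established only later.\<close>

lemma \<sigma>_one:
  assumes "a \<in> carrier K"
  shows "\<sigma> \<one>\<^bsub>G\<^esub> a = a"
proof -
  have "\<sigma> \<one>\<^bsub>G\<^esub> (\<sigma> \<one>\<^bsub>G\<^esub> a) = \<sigma> \<one>\<^bsub>G\<^esub> a"
    using \<sigma>_mult[of "\<one>\<^bsub>G\<^esub>" "\<one>\<^bsub>G\<^esub>" a] assms by simp
  moreover have "inj_on (\<sigma> \<one>\<^bsub>G\<^esub>) (carrier K)"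
    using \<sigma>_bij[of "\<one>\<^bsub>G\<^esub>"] by (simp add: bij_betw_def)
  ultimately show ?thesis
    using assms \<sigma>_closed[of "\<one>\<^bsub>G\<^esub>" a] by (meson G.one_closed inj_onD)
qed

lemma \<sigma>_hom_cring: "g \<in> carrier G \<Longrightarrow> ring_hom_cring K K (\<sigma> g)"
  using \<sigma>_ring_hom K.is_cring by (simp add: ring_hom_cring_def ring_hom_cring_axioms_def)

lemma \<sigma>_zero: "g \<in> carrier G \<Longrightarrow> \<sigma> g \<zero>\<^bsub>K\<^esub> = \<zero>\<^bsub>K\<^esub>"
  using ring_hom_cring.hom_zero[OF \<sigma>_hom_cring] .

lemma transformal_poly_map_const:
  "g \<in> carrier G \<Longrightarrow>
    transformal_poly_map G K \<sigma> g (K.indexed_const c) = K.indexed_const (\<sigma> g c)"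
  by (auto simp: transformal_poly_map_def K.indexed_const_def \<sigma>_zero)

lemma transformal_poly_map_padd:
  assumes "g \<in> carrier G" "K.carrier_coeff P" "K.carrier_coeff Q"
  shows "transformal_poly_map G K \<sigma> g (K.indexed_padd P Q) =
    K.indexed_padd (transformal_poly_map G K \<sigma> g P) (transformal_poly_map G K \<sigma> g Q)"
  using assms ring_hom_add[OF \<sigma>_ring_hom[OF assms(1)]]
  by (auto simp: transformal_poly_map_def K.indexed_padd_def K.carrier_coeff_def)

text \<open>On variables the action sends X_(i,j) to X_(gi,j), although
  \<open>transformal_poly_map\<close> reads coefficients at the monomial translated by the inverse
  of g. The two agree because gi occurs in m exactly when i occurs in the translate.\<close>

lemma transformal_poly_map_pmult:
  assumes g: "g \<in> carrier G" and i: "i \<in> carrier G"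
  shows "transformal_poly_map G K \<sigma> g (K.indexed_pmult P (i, j)) =
    K.indexed_pmult (transformal_poly_map G K \<sigma> g P) (g \<otimes>\<^bsub>G\<^esub> i, j)"
proof
  fix m :: "('g \<times> nat) multiset"
  let ?act = "\<lambda>(h, i). (inv\<^bsub>G\<^esub> g \<otimes>\<^bsub>G\<^esub> h, i :: nat)"
  let ?gi = "(g \<otimes>\<^bsub>G\<^esub> i, j)"
  have act: "?act ?gi = (i, j)"
    using g i by (simp flip: G.m_assoc)
  show "transformal_poly_map G K \<sigma> g (K.indexed_pmult P (i, j)) m =
    K.indexed_pmult (transformal_poly_map G K \<sigma> g P) ?gi m"
  proof (cases "?gi \<in># m")
    case True
    then obtain m' where m: "m = add_mset ?gi m'" by (metis insert_DiffM)
    show ?thesis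
      using g i act by (simp add: transformal_poly_map_def K.indexed_pmult_def m)
  next
    case False
    \<comment> \<open>Only h = gi is translated to i, but cancelling the inverse of g requires h in
      G. This is what the guard on the variables of m provides.\<close>
    have "(i, j) \<notin># image_mset ?act m" if "fst ` set_mset m \<subseteq> carrier G"
    proof
      assume "(i, j) \<in># image_mset ?act m"
      then obtain h where h: "(h, j) \<in># m" "inv\<^bsub>G\<^esub> g \<otimes>\<^bsub>G\<^esub> h = i"
        by auto
      then have "h \<in> carrier G" using that by force
      then have "h = g \<otimes>\<^bsub>G\<^esub> i" using h g by (auto simp flip: G.m_assoc)
      with h False show False by simp
    qed
    with False show ?thesis
      using g by (simp add: transformal_poly_map_def K.indexed_pmult_def \<sigma>_zero)
  qed
qed

text \<open>The action law for \<tau> is demanded only at x: the ideal is the kernel of evaluation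
  at the point with coordinates \<tau>_g x, and its invariance rests on \<tau>_(gh) x = \<tau>_g
  (\<tau>_h x).\<close>

lemma root_of_transformal_extension:
  fixes L :: "('l, 'd) ring_scheme"
  assumes TCF: "TCF_model G K \<sigma>"
    and L: "field L" and \<iota>: "\<iota> \<in> ring_hom K L"
    and \<tau>: "\<And>g. g \<in> carrier G \<Longrightarrow> \<tau> g \<in> ring_hom L L"
    and \<tau>\<iota>: "\<And>g a. g \<in> carrier G \<Longrightarrow> a \<in> carrier K \<Longrightarrow> \<tau> g (\<iota> a) = \<iota> (\<sigma> g a)"
    and x: "x \<in> carrier L"
    and \<tau>_mult: "\<And>g g'. g \<in> carrier G \<Longrightarrow> g' \<in> carrier G \<Longrightarrow>
      \<tau> (g \<otimes>\<^bsub>G\<^esub> g') x = \<tau> g (\<tau> g' x)"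
    and \<tau>_one: "\<tau> \<one>\<^bsub>G\<^esub> x = x"
    and p: "set p \<subseteq> carrier K" "ring.eval L (map \<iota> p) x = \<zero>\<^bsub>L\<^esub>"
  obtains a where "a \<in> carrier K" "K.eval p a = \<zero>\<^bsub>K\<^esub>"
proof -
  interpret L: field L by fact
  interpret \<iota>: ring_hom_cring K L \<iota>
    using \<iota> K.is_cring L.is_cring by (simp add: ring_hom_cring_def ring_hom_cring_axioms_def)
  interpret id: ring_hom_cring K K "\<lambda>a. a"
    using K.is_cring by (simp add: ring_hom_cring_def ring_hom_cring_axioms_def ring_hom_def)
  define V where "V = transformal_vars G 1"
  define r where "r = (\<lambda>(g, i :: nat). \<tau> g x)"
  let ?M = "K.mpoly_ring V"
  define \<phi> where "\<phi> = (\<lambda>P. L.mpoly_eval (\<lambda>m. \<iota> (P m)) r)"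
  have V: "(g, i) \<in> V \<longleftrightarrow> g \<in> carrier G \<and> i = 1" for g i
    by (auto simp: V_def transformal_vars_def)
  have r: "r \<in> V \<rightarrow> carrier L"
    using \<tau> x ring_hom_closed by (fastforce simp: V_def transformal_vars_def r_def)
  interpret M: cring ?M by (rule K.mpoly_ring_is_cring)
  have \<phi>_hom: "\<phi> \<in> ring_hom ?M L"
    unfolding \<phi>_def by (rule \<iota>.mpoly_eval_is_hom[OF r])
  interpret \<phi>: ring_hom_ring ?M L \<phi>
    using \<phi>_hom M.ring_axioms L.ring_axioms by (rule ring_hom_ringI2[rotated 2])
  \<comment> \<open>Evaluation at the point intertwines the two actions of g, which makes its kernel
    invariant. Along the generating rules, constants use the compatibility of \<tau> with \<iota>,
    and variables use the action law at x.\<close>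
  have \<phi>_tau: "transformal_poly_map G K \<sigma> g P \<in> K.indexed_pset V (carrier K) \<and>
      \<phi> (transformal_poly_map G K \<sigma> g P) = \<tau> g (\<phi> P)"
    if g: "g \<in> carrier G" and "P \<in> K.indexed_pset V (carrier K)" for g P
  proof -
    interpret \<tau>: ring_hom_cring L L "\<tau> g"
      using \<tau>[OF g] L.is_cring by (simp add: ring_hom_cring_def ring_hom_cring_axioms_def)
    note \<phi>_simps = \<phi>_def \<iota>.map_indexed_const \<iota>.map_indexed_padd \<iota>.map_indexed_pmult K.pset_coeff[where V = V]
      L.mpoly_eval_const L.mpoly_eval_padd[OF r] L.mpoly_eval_pmult[OF r] \<iota>.map_indexed_pset
      L.mpoly_eval_closed[OF r]
    from that(2) show ?thesis
    proof induction
      case (indexed_const k)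
      then show ?case
        using g \<tau>\<iota> by (simp add: transformal_poly_map_const \<phi>_simps \<sigma>_closed K.indexed_pset.indexed_const)
    next
      case (indexed_padd P Q)
      then show ?case
        using g by (simp add: transformal_poly_map_padd \<phi>_simps K.indexed_pset.indexed_padd)
    next
      case (indexed_pmult P i)
      then obtain h where h: "i = (h, 1)" "h \<in> carrier G" using V by (cases i) auto
      have "(g \<otimes>\<^bsub>G\<^esub> h, 1) \<in> V" using g h V by simp
      moreover have "r (g \<otimes>\<^bsub>G\<^esub> h, 1) = \<tau> g (r i)"
        using g h \<tau>_mult by (simp add: r_def)
      moreover have "r i \<in> carrier L" using r indexed_pmult by blast
      ultimately show ?case
        using g h indexed_pmult
        by (simp add: transformal_poly_map_pmult \<phi>_simps K.indexed_pset.indexed_pmult)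
    qed
  qed
  let ?I = "{P \<in> carrier ?M. \<phi> P \<in> {\<zero>\<^bsub>L\<^esub>}}"
  have "primeideal ?I ?M"
    using \<phi>.primeideal_vimage[OF M.is_cring L.zeroprimeideal] .
  moreover have "transformal_invariant G K \<sigma> ?I"
    unfolding transformal_invariant_def
  proof (intro ballI subsetI)
    fix g Q assume g: "g \<in> carrier G" and "Q \<in> transformal_poly_map G K \<sigma> g ` ?I"
    then obtain P where P: "P \<in> carrier ?M" "\<phi> P = \<zero>\<^bsub>L\<^esub>" "Q = transformal_poly_map G K \<sigma> g P"
      by auto
    have zero: "\<tau> g \<zero>\<^bsub>L\<^esub> = \<zero>\<^bsub>L\<^esub>"
      using ring_hom_cring.hom_zero[of L L "\<tau> g"] \<tau>[OF g] L.is_cring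
      by (simp add: ring_hom_cring_def ring_hom_cring_axioms_def)
    have "P \<in> K.indexed_pset V (carrier K)" using P(1) K.carrier_mpoly_ring by blast
    from \<phi>_tau[OF g this] have "Q \<in> carrier ?M" "\<phi> Q = \<zero>\<^bsub>L\<^esub>"
      unfolding P(3) P(2) K.carrier_mpoly_ring zero by blast+
    then show "Q \<in> ?I" by blast
  qed
  \<comment> \<open>The whole ring contains 1 and so has no zeros. With this J the axiom says just
    that I has a zero with coordinates \<sigma>_g a.\<close>
  moreover have "ideal (carrier ?M) ?M" by (rule M.oneideal)
  moreover have "?I \<subset> carrier ?M"
  proof -
    have "\<phi> \<one>\<^bsub>?M\<^esub> \<noteq> \<zero>\<^bsub>L\<^esub>" using ring_hom_one[OF \<phi>_hom] L.one_not_zero by simp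
    then show ?thesis using M.one_closed by blast
  qed
  ultimately have "\<exists>a\<in>{1..1} \<rightarrow>\<^sub>E carrier K.
      transformal_point G \<sigma> 1 a \<in> K.zero_locus V ?I - K.zero_locus V (carrier ?M)"
    using TCF unfolding TCF_model_def V_def by blast
  then obtain a where a: "a \<in> {1..1} \<rightarrow>\<^sub>E carrier K"
    "transformal_point G \<sigma> 1 a \<in> K.zero_locus V ?I"
    by blast
  \<comment> \<open>Placed in the variable of the neutral element, p lies in the kernel because
    \<tau>_1 x = x, and at the point supplied by the axiom it takes the value p(a) because
    \<sigma>_1 a = a.\<close>
  define P where "P = ring.eval ?M (map K.indexed_const p) (K.indexed_var (\<one>\<^bsub>G\<^esub>, 1))"
  have "(\<one>\<^bsub>G\<^esub>, 1) \<in> V" using V by simp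
  note P = \<iota>.mpoly_eval_univariate[OF r this p(1), folded P_def]
  have "P \<in> ?I" using P p(2) \<tau>_one by (simp add: \<phi>_def r_def)
  then have zero: "K.mpoly_eval P (transformal_point G \<sigma> 1 a) = \<zero>\<^bsub>K\<^esub>"
    using a(2) unfolding K.zero_locus_def by blast
  have a1: "a 1 \<in> carrier K" using a(1) by auto
  have point: "transformal_point G \<sigma> 1 a \<in> V \<rightarrow> carrier K"
    using a1 \<sigma>_closed by (auto simp: transformal_point_def V_def transformal_vars_def)
  have "transformal_point G \<sigma> 1 a (\<one>\<^bsub>G\<^esub>, 1) = \<sigma> \<one>\<^bsub>G\<^esub> (a 1)"
    using \<open>(\<one>\<^bsub>G\<^esub>, 1) \<in> V\<close> by (simp add: transformal_point_def V_def)
  then have "K.eval p (a 1) = \<zero>\<^bsub>K\<^esub>"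
    using id.mpoly_eval_univariate(2)[OF point \<open>(\<one>\<^bsub>G\<^esub>, 1) \<in> V\<close> p(1), folded P_def] zero
    unfolding \<sigma>_one[OF a1] list.map_ident by metis
  with a1 that show thesis by blast
qed

end

section \<open>Splitting an extension with abelian kernel of coprime order\<close>

lemma (in comm_monoid) hom_finprod:
  assumes "h \<in> hom G G" "h \<one> = \<one>" "f \<in> A \<rightarrow> carrier G"
  shows "h (finprod G f A) = finprod G (\<lambda>x. h (f x)) A"
proof (cases "finite A")
  case True
  then show ?thesis
    using assms(3)
  proof (induction A)
    case (insert a A)
    then have "(\<lambda>x. h (f x)) \<in> A \<rightarrow> carrier G" "h (f a) \<in> carrier G"
      using assms(1) by (auto simp: hom_def)
    with insert show ?case using assms(1) by (simp add: hom_mult Pi_def)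
  qed (simp add: assms)
qed (simp add: assms)

text \<open>This is the vanishing of the second cohomology of Q with values in N for coprime orders,
  the abelian case of the Schur-Zassenhaus theorem. It is phrased for a section s that normalises N
  and is multiplicative modulo N, so that no quotient group has to be formed.\<close>

lemma (in group) lift_hom_of_coprime:
  assumes Q: "group Q" "finite (carrier Q)"
    and N: "subgroup N G" "finite N" "coprime (card N) (card (carrier Q))"
    and N_comm: "\<And>a b. a \<in> N \<Longrightarrow> b \<in> N \<Longrightarrow> a \<otimes> b = b \<otimes> a"
    and s: "\<And>q. q \<in> carrier Q \<Longrightarrow> s q \<in> carrier G"
    and conj: "\<And>q n. q \<in> carrier Q \<Longrightarrow> n \<in> N \<Longrightarrow> s q \<otimes> n \<otimes> inv (s q) \<in> N"
    and s_mult: "\<And>q q'. q \<in> carrier Q \<Longrightarrow> q' \<in> carrier Q \<Longrightarrow>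
      s q \<otimes> s q' \<otimes> inv (s (q \<otimes>\<^bsub>Q\<^esub> q')) \<in> N"
  obtains t where "t \<in> hom Q G" "\<And>q. q \<in> carrier Q \<Longrightarrow> \<exists>n\<in>N. t q = n \<otimes> s q"
proof -
  interpret Q: group Q by fact
  interpret N: subgroup N G by fact
  define M where "M = G\<lparr>carrier := N\<rparr>"
  have M_simps: "carrier M = N" "monoid.mult M = monoid.mult G" "\<one>\<^bsub>M\<^esub> = \<one>" by (simp_all add: M_def)
  interpret M: comm_group M
    using N.subgroup_is_group[OF is_group] N_comm
    by (auto intro!: group.group_comm_groupI simp: M_def)
  have M_pow: "x [^]\<^bsub>M\<^esub> k = x [^] k" for x and k :: nat
    by (simp add: M_def nat_pow_consistent[symmetric])
  have M_inv: "inv\<^bsub>M\<^esub> x = inv x" if "x \<in> N" for x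
    using that by (simp add: M_def m_inv_consistent N.subgroup_axioms)
  \<comment> \<open>Here \<open>\<kappa>\<close> is the conjugation action on N, \<open>c\<close>
    the factor set of the section s, and \<open>b\<close> the cochain that averages it.\<close>
  define \<kappa> where "\<kappa> q n = s q \<otimes> n \<otimes> inv (s q)" for q n
  define c where "c q q' = s q \<otimes> s q' \<otimes> inv (s (q \<otimes>\<^bsub>Q\<^esub> q'))" for q q'
  define b where "b q = finprod M (c q) (carrier Q)" for q
  let ?e = "card (carrier Q)"
  have c_closed: "c q q' \<in> N" if "q \<in> carrier Q" "q' \<in> carrier Q" for q q'
    using s_mult[OF that] by (simp add: c_def)
  have b_closed: "b q \<in> N" if "q \<in> carrier Q" for q
    using c_closed that M.finprod_closed[of "c q" "carrier Q"] by (auto simp: b_def M_simps)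
  have \<kappa>_hom: "\<kappa> q \<in> hom M M" if q: "q \<in> carrier Q" for q
  proof (intro homI)
    fix x y assume "x \<in> carrier M" "y \<in> carrier M"
    then have "x \<in> carrier G" "y \<in> carrier G" by (auto simp: M_simps)
    then show "\<kappa> q (x \<otimes>\<^bsub>M\<^esub> y) = \<kappa> q x \<otimes>\<^bsub>M\<^esub> \<kappa> q y"
      using s[OF q] by (simp add: \<kappa>_def M_simps m_assoc inv_solve_left)
  qed (use conj q in \<open>auto simp: \<kappa>_def M_simps\<close>)
  have \<kappa>_closed: "\<kappa> q n \<in> N" if "q \<in> carrier Q" "n \<in> N" for q n
    using conj that by (simp add: \<kappa>_def)
  have \<kappa>_one: "\<kappa> q \<one> = \<one>" if "q \<in> carrier Q" for q
    using s[OF that] by (simp add: \<kappa>_def)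
  \<comment> \<open>Both sides equal s_g s_h s_k times the inverse of s_(ghk), so this is
    associativity in the ambient group.\<close>
  have cocycle: "\<kappa> g (c h k) \<otimes> c g (h \<otimes>\<^bsub>Q\<^esub> k) = c g h \<otimes> c (g \<otimes>\<^bsub>Q\<^esub> h) k"
    if "g \<in> carrier Q" "h \<in> carrier Q" "k \<in> carrier Q" for g h k
  proof -
    have cancel: "inv x \<otimes> (x \<otimes> y) = y" if "x \<in> carrier G" "y \<in> carrier G" for x y
      using that by (simp flip: m_assoc)
    show ?thesis
      using that s by (simp add: \<kappa>_def c_def m_assoc cancel Q.m_assoc)
  qed
  \<comment> \<open>Multiplying the cocycle identity over all \<open>k\<close> makes the \<open>|Q|\<close>-th power of the cocycle a coboundary.\<close>
  have average: "\<kappa> g (b h) \<otimes> b g = c g h [^] ?e \<otimes> b (g \<otimes>\<^bsub>Q\<^esub> h)"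
    if g: "g \<in> carrier Q" and h: "h \<in> carrier Q" for g h
  proof -
    have "\<kappa> g (b h) = finprod M (\<lambda>k. \<kappa> g (c h k)) (carrier Q)"
      unfolding b_def using \<kappa>_hom[OF g] \<kappa>_one[OF g] c_closed[OF h]
      by (intro M.hom_finprod) (auto simp: M_simps)
    moreover have "b g = finprod M (\<lambda>k. c g (h \<otimes>\<^bsub>Q\<^esub> k)) (carrier Q)"
    proof -
      have surj: "(\<lambda>k. h \<otimes>\<^bsub>Q\<^esub> k) ` carrier Q = carrier Q"
        using h Q.surj_const_mult by simp
      have "finprod M (c g) ((\<lambda>k. h \<otimes>\<^bsub>Q\<^esub> k) ` carrier Q) =
          finprod M (\<lambda>k. c g (h \<otimes>\<^bsub>Q\<^esub> k)) (carrier Q)"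
        using c_closed[OF g] h Q.inj_on_multc Q.inj_on_cmult
        by (intro M.finprod_reindex) (auto simp: M_simps)
      then show ?thesis unfolding surj b_def .
    qed
    ultimately have "\<kappa> g (b h) \<otimes> b g =
        finprod M (\<lambda>k. \<kappa> g (c h k) \<otimes> c g (h \<otimes>\<^bsub>Q\<^esub> k)) (carrier Q)"
      using g h c_closed \<kappa>_closed
      by (subst M.finprod_multf[unfolded M_simps]) (auto simp: M_simps)
    also have "\<dots> = finprod M (\<lambda>k. c g h \<otimes> c (g \<otimes>\<^bsub>Q\<^esub> h) k) (carrier Q)"
      using g h c_closed cocycle by (intro M.finprod_cong') (auto simp: M_simps)
    also have "\<dots> = finprod M (\<lambda>k. c g h) (carrier Q) \<otimes> b (g \<otimes>\<^bsub>Q\<^esub> h)"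
      unfolding b_def using g h c_closed
      by (subst M.finprod_multf[unfolded M_simps]) (auto simp: M_simps)
    also have "finprod M (\<lambda>k. c g h) (carrier Q) = c g h [^] ?e"
      using g h c_closed by (subst M.finprod_const) (auto simp: M_simps M_pow)
    finally show ?thesis .
  qed
  have "?e \<noteq> 0" using Q Q.one_closed by (metis card_eq_0_iff empty_iff)
  \<comment> \<open>By coprimality, raising to the power \<open>|Q| d\<close> is the identity on \<open>N\<close>, so \<open>b ^ d\<close> trivialises the
    cocycle itself.\<close>
  then obtain d y where d: "?e * d = card N * y + 1"
    using bezout_nat[of ?e "card N"] N(3) by (auto simp: coprime_iff_gcd_eq_1 gcd.commute)
  have pow: "x [^] (?e * d) = x" if "x \<in> N" for x
  proof -
    have "x [^] card N = \<one>"
      using M.pow_order_eq_1[of x] that N(2) by (simp add: M_simps M_pow order_def)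
    then show ?thesis
      using that by (simp add: d nat_pow_mult[symmetric] nat_pow_pow[symmetric])
  qed
  define t where "t q = inv (b q [^] d) \<otimes> s q" for q
  have bd: "b q [^] d \<in> N" if "q \<in> carrier Q" for q
    using M.nat_pow_closed[of "b q" d] b_closed[OF that] by (simp add: M_simps M_pow)
  have t_mult: "t (g \<otimes>\<^bsub>Q\<^esub> h) = t g \<otimes> t h" if g: "g \<in> carrier Q" and h: "h \<in> carrier Q" for g h
  proof -
    note closed = b_closed[OF g] b_closed[OF h] c_closed[OF g h] \<kappa>_closed[OF g b_closed[OF h]]
      b_closed[OF Q.m_closed[OF g h]]
    have pow_hom: "\<kappa> g (x [^] k) = \<kappa> g x [^] k" if "x \<in> N" for x and k :: nat
      using that \<kappa>_hom[OF g] \<kappa>_one[OF g] M.nat_pow_closed[of x]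
      by (induction k) (auto simp: hom_def M_simps M_pow)
    have inv_hom: "\<kappa> g (inv x) = inv (\<kappa> g x)" if "x \<in> N" for x
      using that s[OF g] by (simp add: \<kappa>_def inv_mult_group m_assoc)
    have "(\<kappa> g (b h) \<otimes> b g) [^] d = c g h [^] (?e * d) \<otimes> b (g \<otimes>\<^bsub>Q\<^esub> h) [^] d"
      unfolding average[OF g h] using closed M.nat_pow_closed[of "c g h" ?e]
      by (subst pow_mult_distrib) (auto simp: nat_pow_pow M_simps M_pow N_comm)
    then have key: "\<kappa> g (b h [^] d) \<otimes> b g [^] d = c g h \<otimes> b (g \<otimes>\<^bsub>Q\<^esub> h) [^] d"
      using closed pow pow_mult_distrib[OF N_comm[OF closed(4) closed(1)], of d]
      by (simp add: pow_hom)
    have cancel: "inv x \<otimes> (x \<otimes> y) = y" "x \<otimes> (inv x \<otimes> y) = y"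
      if "x \<in> carrier G" "y \<in> carrier G" for x y
      using that by (simp_all flip: m_assoc)
    \<comment> \<open>Moving s_g to the right past the inverse of b_h^d conjugates that inverse. By
      \<open>key\<close>, the factors from N then combine to the inverse of c_(g,h) b_(gh)^d, which
      cancels the factor set.\<close>
    have "t g \<otimes> t h = inv (b g [^] d) \<otimes> inv (\<kappa> g (b h [^] d)) \<otimes> (s g \<otimes> s h)"
      using s g h bd inv_hom[OF bd[OF h]] by (simp add: t_def \<kappa>_def m_assoc cancel inv_mult_group)
    also have "s g \<otimes> s h = c g h \<otimes> s (g \<otimes>\<^bsub>Q\<^esub> h)"
      using s g h by (simp add: c_def m_assoc)
    also have "inv (b g [^] d) \<otimes> inv (\<kappa> g (b h [^] d)) = inv (c g h \<otimes> b (g \<otimes>\<^bsub>Q\<^esub> h) [^] d)"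
      using bd[OF g] bd[OF h] \<kappa>_closed[OF g] by (simp add: key[symmetric] inv_mult_group)
    also have "\<dots> \<otimes> (c g h \<otimes> s (g \<otimes>\<^bsub>Q\<^esub> h)) = t (g \<otimes>\<^bsub>Q\<^esub> h)"
      using s g h bd[OF Q.m_closed[OF g h]] closed
      by (simp add: t_def inv_mult_group m_assoc cancel)
    finally show ?thesis by simp
  qed
  show thesis
  proof
    show "t \<in> hom Q G"
      using t_mult s bd by (auto simp: hom_def t_def)
    show "\<exists>n\<in>N. t q = n \<otimes> s q" if "q \<in> carrier Q" for q
      using bd[OF that] by (auto simp: t_def)
  qed
qed

section \<open>Extending isomorphisms to simple extensions\<close>

text \<open>Polynomials are coefficient lists without leading zeros. A field homomorphism is
  injective, so mapping the coefficients never creates a leading zero and the image list needs no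
  trimming.\<close>

lemma map_poly_hom:
  assumes A: "field A" and B: "field B" and h: "h \<in> ring_hom A B"
  shows "map h \<in> ring_hom (poly_ring A) (poly_ring B)"
proof -
  interpret A: field A by fact
  interpret B: field B by fact
  interpret h: ring_hom_ring A B h
    using A.ring_axioms B.ring_axioms h by (rule ring_hom_ringI2)
  have closed: "map h p \<in> carrier (poly_ring B)" if "p \<in> carrier (poly_ring A)" for p
    using that polynomial_hom[OF h A B] by blast
  have norm: "B.normalize (map h p) = map h p" if "p \<in> carrier (poly_ring A)" for p
    using closed[OF that] B.normalize_polynomial by (simp add: univ_poly_carrier[symmetric])
  have incl: "set p \<subseteq> carrier A" if "p \<in> carrier (poly_ring A)" for p
    using that by (auto simp: univ_poly_carrier[symmetric] polynomial_def)
  show ?thesis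
  proof (intro ring_hom_memI)
    fix p q assume p: "p \<in> carrier (poly_ring A)" and q: "q \<in> carrier (poly_ring A)"
    have "A.poly_mult p q \<in> carrier (poly_ring A)" "A.poly_add p q \<in> carrier (poly_ring A)"
      using p q A.poly_mult_closed A.poly_add_closed A.carrier_is_subring
      unfolding univ_poly_carrier[symmetric] by blast+
    then show "map h (p \<otimes>\<^bsub>poly_ring A\<^esub> q) = map h p \<otimes>\<^bsub>poly_ring B\<^esub> map h q"
      "map h (p \<oplus>\<^bsub>poly_ring A\<^esub> q) = map h p \<oplus>\<^bsub>poly_ring B\<^esub> map h q"
      using h.poly_mult_hom'[OF incl[OF p] incl[OF q]] h.poly_add_hom'[OF incl[OF p] incl[OF q]]
        norm by (simp_all add: univ_poly_mult univ_poly_add)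
  qed (use closed in \<open>auto simp: univ_poly_one\<close>)
qed

text \<open>A factorisation of the image is pulled back along the inverse isomorphism. Over a field
  the units are the nonzero constants, a condition on the length of the list alone, so
  \<open>map\<close> preserves and reflects them.\<close>

lemma pirreducible_map:
  assumes A: "field A" and B: "field B" and h: "h \<in> ring_iso A B"
    and p: "p \<in> carrier (poly_ring A)" "pirreducible\<^bsub>A\<^esub> (carrier A) p"
  shows "pirreducible\<^bsub>B\<^esub> (carrier B) (map h p)"
proof -
  interpret A: field A by fact
  interpret B: field B by fact
  define k where "k = inv_into (carrier A) h"
  have h_hom: "h \<in> ring_hom A B" and bij: "bij_betw h (carrier A) (carrier B)"
    using h by (auto simp: ring_iso_def)
  have k_hom: "k \<in> ring_hom B A"
    using ring_iso_set_sym[OF A.ring_axioms h] by (simp add: k_def ring_iso_def)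
  have "k (h a) = a" if "a \<in> carrier A" for a
    using that bij by (simp add: k_def bij_betw_def)
  moreover have "set p \<subseteq> carrier A"
    using p(1) by (auto simp: univ_poly_carrier[symmetric] polynomial_def)
  ultimately have kh: "map k (map h p) = p"
    by (induction p) auto
  note hP = map_poly_hom[OF A B h_hom] and kP = map_poly_hom[OF B A k_hom]
  have deg: "degree p \<ge> 1"
    using A.pirreducible_degree[OF A.carrier_is_subfield p] .
  show ?thesis
  proof (rule B.pirreducibleI[OF B.carrier_is_subring])
    show "map h p \<in> carrier (poly_ring B)"
      using ring_hom_closed[OF hP p(1)] .
    show "map h p \<noteq> []" using deg by auto
    show "map h p \<notin> Units (poly_ring B)"
      using deg unfolding B.univ_poly_units'[OF B.carrier_is_subfield] by simp arith
    fix q r assume q: "q \<in> carrier (poly_ring B)" and r: "r \<in> carrier (poly_ring B)"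
      and qr: "map h p = q \<otimes>\<^bsub>poly_ring B\<^esub> r"
    have "p = map k q \<otimes>\<^bsub>poly_ring A\<^esub> map k r"
      using ring_hom_mult[OF kP q r] unfolding qr[symmetric] kh .
    then have "map k q \<in> Units (poly_ring A) \<or> map k r \<in> Units (poly_ring A)"
      using A.pirreducibleE(3)[OF A.carrier_is_subring p] ring_hom_closed[OF kP q]
        ring_hom_closed[OF kP r] by blast
    then show "q \<in> Units (poly_ring B) \<or> r \<in> Units (poly_ring B)"
      using q r unfolding A.univ_poly_units'[OF A.carrier_is_subfield]
        B.univ_poly_units'[OF B.carrier_is_subfield] by simp blast
  qed
qed

context field
begin

text \<open>\<open>Irr F x\<close> is a distinguished minimal polynomial, whereas p is any
  irreducible polynomial vanishing at x. Minimality makes \<open>Irr F x\<close> divide p, and a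
  non-unit divisor of an irreducible element is associated to it.\<close>

lemma pirreducible_associated_Irr:
  assumes F: "subfield F R" and p: "p \<in> carrier (F[X])" "pirreducible F p"
    and x: "x \<in> carrier R" "eval p x = \<zero>"
  shows "(algebraic over F) x" and "Irr F x \<sim>\<^bsub>F[X]\<^esub> p" and "degree (Irr F x) = degree p"
proof -
  have "p \<noteq> []" using pirreducibleE(1)[OF subfieldE(1)[OF F] p] .
  then show alg: "(algebraic over F) x"
    using algebraicI p(1) x(2) by blast
  note Irr = IrrE[OF F x(1) alg]
  have "Irr F x divides\<^bsub>F[X]\<^esub> p"
    using Irr_minimal[OF F x(1) alg p(1) x(2)] pdivides_iff_shell[OF F Irr(1) p(1)] by simp
  moreover have "Irr F x \<notin> Units (F[X])"
    using pirreducibleE(2)[OF subfieldE(1)[OF F] Irr(1,2)] .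
  ultimately show "Irr F x \<sim>\<^bsub>F[X]\<^esub> p"
    using divides_pirreducible_condition[OF p(2) Irr(1)] by blast
  then show "degree (Irr F x) = degree p"
    using associated_polynomials_imp_same_length[OF subfieldE(1)[OF F] Irr(1) p(1)] by simp
qed

lemma pirreducible_divides:
  assumes F: "subfield F R" and p: "p \<in> carrier (F[X])" "pirreducible F p"
    and x: "x \<in> carrier R" "eval p x = \<zero>" and q: "q \<in> carrier (F[X])" "eval q x = \<zero>"
  shows "p divides\<^bsub>F[X]\<^esub> q"
proof -
  interpret UP: principal_domain "F[X]" using univ_poly_is_principal[OF F] .
  note Irr = pirreducible_associated_Irr[OF F p x]
  have "Irr F x divides\<^bsub>F[X]\<^esub> q"
    using Irr_minimal[OF F x(1) Irr(1) q] pdivides_iff_shell[OF F IrrE(1)[OF F x(1) Irr(1)] q(1)]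
    by simp
  then show ?thesis
    using UP.divides_cong_l[OF UP.associated_sym[OF Irr(2)]] p(1) IrrE(1)[OF F x(1) Irr(1)]
    by blast
qed

lemma dimension_simple_extension':
  assumes "subfield F R" "p \<in> carrier (F[X])" "pirreducible F p" "x \<in> carrier R" "eval p x = \<zero>"
  shows "dimension (degree p) F (simple_extension F x)" and "subfield (simple_extension F x) R"
  using pirreducible_associated_Irr[OF assms] dimension_simple_extension[OF assms(1,4)]
    simple_extension_is_subfield[OF assms(1,4)] by auto

text \<open>F(x) is F[X] modulo p, so q(x) can be sent to s(q)(y) as soon as s(p) vanishes at y. The
  target is the ambient field because y may lie outside F(x); the last conclusion serves to compute
  the image.\<close>

lemma extend_hom_simple_extension:
  assumes F: "subfield F R" and s: "s \<in> ring_hom (R\<lparr>carrier := F\<rparr>) (R\<lparr>carrier := F\<rparr>)"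
    and p: "p \<in> carrier (F[X])" "pirreducible F p"
    and x: "x \<in> carrier R" "eval p x = \<zero>" and y: "y \<in> carrier R" "eval (map s p) y = \<zero>"
  obtains t where "t \<in> ring_hom (R\<lparr>carrier := simple_extension F x\<rparr>) R"
    and "\<And>k. k \<in> F \<Longrightarrow> t k = s k" and "t x = y"
    and "\<And>q. q \<in> carrier (F[X]) \<Longrightarrow> t (eval q x) = eval (map s q) y"
proof -
  have Ffield: "field (R\<lparr>carrier := F\<rparr>)" using subfield_iff(2)[OF F] .
  have Fring: "subring F R" using subfieldE(1)[OF F] .
  have F_sub: "F \<subseteq> carrier R" using subfieldE(3)[OF F] .
  have FX: "poly_ring (R\<lparr>carrier := F\<rparr>) = F[X]" using univ_poly_consistent[OF Fring] by simp
  note sX = map_poly_hom[OF Ffield Ffield s, unfolded FX]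
  interpret UP: principal_domain "F[X]" using univ_poly_is_principal[OF F] .
  interpret sX: ring_hom_ring "F[X]" "F[X]" "map s"
    using UP.ring_axioms UP.ring_axioms sX by (rule ring_hom_ringI2)
  interpret ex: ring_hom_ring "F[X]" R "\<lambda>q. eval q x" using eval_ring_hom[OF Fring x(1)] .
  interpret ey: ring_hom_ring "F[X]" R "\<lambda>q. eval q y" using eval_ring_hom[OF Fring y(1)] .
  have well_def: "eval (map s q) y = eval (map s q') y"
    if q: "q \<in> carrier (F[X])" and q': "q' \<in> carrier (F[X])" and eq: "eval q x = eval q' x" for q q'
  proof -
    let ?d = "q \<ominus>\<^bsub>F[X]\<^esub> q'"
    have d: "?d \<in> carrier (F[X])" using q q' by simp
    have "eval ?d x = \<zero>"
      using q q' eq by (simp add: a_minus_def r_neg)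
    then have "p divides\<^bsub>F[X]\<^esub> ?d" using pirreducible_divides[OF F p x d] by simp
    then obtain r where r: "r \<in> carrier (F[X])" "?d = p \<otimes>\<^bsub>F[X]\<^esub> r" unfolding factor_def by blast
    have "eval (map s ?d) y = \<zero>"
      using p(1) r y by (simp add: eval_in_carrier)
    then have "eval (map s q) y \<ominus> eval (map s q') y = \<zero>"
      using q q' by (simp add: a_minus_def)
    then show ?thesis using q q' by simp
  qed
  \<comment> \<open>The choice picks a polynomial representing u. By \<open>well_def\<close> the
    value is independent of it, and outside F(x) the value is irrelevant.\<close>
  define t where "t u = eval (map s (SOME q. q \<in> carrier (F[X]) \<and> eval q x = u)) y" for u
  have t_eval: "t (eval q x) = eval (map s q) y" if q: "q \<in> carrier (F[X])" for q
  proof -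
    have "\<exists>q'. q' \<in> carrier (F[X]) \<and> eval q' x = eval q x" using q by blast
    from someI_ex[OF this] show ?thesis unfolding t_def using well_def q by blast
  qed
  have img: "simple_extension F x = (\<lambda>q. eval q x) ` carrier (F[X])"
    using simple_extension_as_eval_img[OF F_sub x(1)] .
  \<comment> \<open>Zero needs its own case: the zero polynomial is the empty list, and the list [0]
    is not a polynomial.\<close>
  have const: "t k = s k" if k: "k \<in> F" for k
  proof (cases "k = \<zero>")
    case True
    have "s \<zero> = \<zero>"
      using ring_hom_cring.hom_zero[of "R\<lparr>carrier := F\<rparr>" "R\<lparr>carrier := F\<rparr>" s] s Ffield
      by (simp add: ring_hom_cring_def ring_hom_cring_axioms_def fieldE(1))
    then show ?thesis using t_eval[of "[]"] True by (simp add: univ_poly_zero_closed)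
  next
    case False
    then have "[k] \<in> carrier (F[X])" using k by (simp add: univ_poly_carrier[symmetric] polynomial_def)
    moreover have "k \<in> carrier R" "s k \<in> carrier R"
      using k F_sub ring_hom_closed[OF s] by auto
    ultimately show ?thesis using t_eval[of "[k]"] x y by simp
  qed
  show thesis
  proof (rule that)
    show "t \<in> ring_hom (R\<lparr>carrier := simple_extension F x\<rparr>) R"
    proof (intro ring_hom_memI)
      fix u v assume "u \<in> carrier (R\<lparr>carrier := simple_extension F x\<rparr>)"
        "v \<in> carrier (R\<lparr>carrier := simple_extension F x\<rparr>)"
      then obtain q r where q: "q \<in> carrier (F[X])" "u = eval q x"
        and r: "r \<in> carrier (F[X])" "v = eval r x" by (auto simp: img)
      show "t u \<in> carrier R" using q by (simp add: t_eval)
      show "t (u \<otimes>\<^bsub>R\<lparr>carrier := simple_extension F x\<rparr>\<^esub> v) = t u \<otimes> t v"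
        using q r t_eval[of "q \<otimes>\<^bsub>F[X]\<^esub> r"] by (simp add: t_eval)
      show "t (u \<oplus>\<^bsub>R\<lparr>carrier := simple_extension F x\<rparr>\<^esub> v) = t u \<oplus> t v"
        using q r t_eval[of "q \<oplus>\<^bsub>F[X]\<^esub> r"] by (simp add: t_eval)
    next
      show "t \<one>\<^bsub>R\<lparr>carrier := simple_extension F x\<rparr>\<^esub> = \<one>"
        using const[of \<one>] ring_hom_one[OF s] subringE(3)[OF Fring] by simp
    qed
    show "t x = y"
      using t_eval[OF var_closed(1)[OF Fring]] eval_var x y ring_hom_one[OF s]
        ring_hom_cring.hom_zero[of "R\<lparr>carrier := F\<rparr>" "R\<lparr>carrier := F\<rparr>" s] s Ffield
      by (simp add: ring_hom_cring_def ring_hom_cring_axioms_def fieldE(1) var_def)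
  qed (fact const t_eval)+
qed

lemma hom_simple_extension_unique:
  assumes F: "subfield F R" and x: "x \<in> carrier R"
    and t: "t \<in> ring_hom (R\<lparr>carrier := simple_extension F x\<rparr>) R"
    and t': "t' \<in> ring_hom (R\<lparr>carrier := simple_extension F x\<rparr>) R"
    and eq: "\<And>k. k \<in> F \<Longrightarrow> t k = t' k" "t x = t' x"
    and u: "u \<in> simple_extension F x"
  shows "t u = t' u"
proof -
  let ?E = "simple_extension F x"
  have F_sub: "F \<subseteq> carrier R" using subfieldE(3)[OF F] .
  have E: "subring ?E R" using simple_extension_is_subring[OF subfieldE(1)[OF F] x] .
  have ER: "ring (R\<lparr>carrier := ?E\<rparr>)" using subring_is_ring[OF E] .
  obtain q where q: "q \<in> carrier (F[X])" "u = eval q x"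
    using u simple_extension_as_eval_img[OF F_sub x] by auto
  have qF: "set q \<subseteq> F" using q(1) by (auto simp: univ_poly_carrier[symmetric] polynomial_def)
  have "h u = eval (map h q) (h x)" if h: "h \<in> ring_hom (R\<lparr>carrier := ?E\<rparr>) R" for h
  proof -
    interpret h: ring_hom_ring "R\<lparr>carrier := ?E\<rparr>" R h
      using ER ring_axioms h by (rule ring_hom_ringI2)
    show ?thesis
      using h.eval_hom'[of x q] qF simple_extension_incl[OF F_sub x]
        simple_extension_mem[OF subfieldE(1)[OF F] x] q(2) eval_consistent[OF E] by auto
  qed
  moreover have "map t q = map t' q" using qF eq(1) by auto
  ultimately show ?thesis using t t' eq(2) by metis
qed

text \<open>By the tower law the degree of x divides q, and it is not 1 because x lies outside F.
  Hence F(x) has the same dimension as E and fills it.\<close>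

lemma simple_extension_of_prime_degree:
  assumes F: "subfield F R" and E: "subfield E R" and FE: "F \<subseteq> E"
    and q: "Factorial_Ring.prime q" "dimension q F E" and x: "x \<in> E" "x \<notin> F"
  shows "simple_extension F x = E" and "(algebraic over F) x" and "degree (Irr F x) = q"
proof -
  let ?D = "simple_extension F x"
  have xR: "x \<in> carrier R" using x subfieldE(3)[OF E] by auto
  have fin: "finite_dimension F E" using q finite_dimensionI by blast
  show alg: "(algebraic over F) x"
    using finite_dimension_imp_algebraic[OF F subfieldE(1)[OF E] fin x(1)] .
  have D: "subfield ?D R" using simple_extension_is_subfield[OF F xR] alg by simp
  have DE: "?D \<subseteq> E" using simple_extension_subring_incl[OF subfieldE(1)[OF E] FE x(1)] .
  have FD: "F \<subseteq> ?D" using simple_extension_incl[OF subfieldE(3)[OF F] xR] .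
  have dimD: "dimension (degree (Irr F x)) F ?D" using dimension_simple_extension[OF F xR alg] .
  \<comment> \<open>The tower law needs E to be finite-dimensional over F(x). A list spanning E over
    F also spans it over F(x).\<close>
  obtain Us where Us: "set Us \<subseteq> carrier R" "Span F Us = E" using exists_base[OF F q(2)] by blast
  have UsE: "set Us \<subseteq> E" using Span_base_incl[OF F Us(1)] Us(2) by simp
  have E_add: "subgroup E (add_monoid R)" using subring.axioms(1)[OF subfieldE(1)[OF E]] .
  have "Span ?D Us \<subseteq> E"
    using subringE(6)[OF subfieldE(1)[OF E]] DE UsE
    by (intro Span_min[OF D Us(1) E_add]) (auto simp: set_mult_def)
  moreover have "E \<subseteq> Span ?D Us"
  proof -
    have "Span F Us \<subseteq> Span ?D Us"
      using FD Span_base_incl[OF D Us(1)] Span_smult_closed[OF D Us(1)]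
      by (intro Span_min[OF F Us(1) Span_is_add_subgroup[OF D Us(1)]]) (auto simp: set_mult_def)
    then show ?thesis using Us(2) by simp
  qed
  ultimately have "finite_dimension ?D E" using Span_finite_dimension[OF D Us(1)] by simp
  then obtain m where m: "dimension m ?D E" by blast
  have "degree (Irr F x) * m = q"
    using telescopic_base[OF F D dimD m] q(2) dimension_is_inj[OF F] by blast
  moreover have "degree (Irr F x) \<noteq> 1"
  proof
    \<comment> \<open>A basis of F over itself would then be a basis of F(x), putting x into
      F.\<close>
    assume deg: "degree (Irr F x) = 1"
    have "dimension 1 F F" using dimension_one[OF F] .
    then obtain Vs where Vs: "independent F Vs" "length Vs = 1" "Span F Vs = F"
      using exists_base[OF F] by blast
    have "set Vs \<subseteq> ?D" using Span_base_incl[OF F] Vs FD independent_in_carrier by blast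
    then have "Span F Vs = ?D"
      using independent_length_eq_dimension[OF F dimD Vs(1)] Vs(2) deg by simp
    then show False
      using x Vs simple_extension_mem[OF subfieldE(1)[OF F] xR] by simp
  qed
  ultimately show deg: "degree (Irr F x) = q"
    using q(1) by (metis dvd_triv_left prime_nat_iff)
  obtain Vs where Vs: "independent F Vs" "length Vs = q" "Span F Vs = ?D"
    using exists_base[OF F dimD] deg by blast
  have "set Vs \<subseteq> E" using Span_base_incl[OF F] Vs DE independent_in_carrier by blast
  then show "?D = E"
    using independent_length_eq_dimension[OF F q(2) Vs(1)] Vs by simp
qed

end

section \<open>Automorphisms of extensions of prime degree\<close>

text \<open>By Lagrange the centraliser of a has order 1 or the full order; if a is not 1, it
  contains both 1 and a and must be the whole group.\<close>

lemma (in group) prime_order_imp_comm: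
  assumes "Factorial_Ring.prime (order G)" and a: "a \<in> carrier G" and b: "b \<in> carrier G"
  shows "a \<otimes> b = b \<otimes> a"
proof (cases "a = \<one>")
  case False
  let ?C = "{c \<in> carrier G. a \<otimes> c = c \<otimes> a}"
  have "subgroup ?C G"
  proof (rule subgroupI)
    fix c assume "c \<in> ?C"
    then have c: "c \<in> carrier G" and ac: "a \<otimes> c = c \<otimes> a" by auto
    have "a \<otimes> inv c = inv c \<otimes> (c \<otimes> a) \<otimes> inv c"
      using a c by (simp add: m_assoc[symmetric])
    also have "\<dots> = inv c \<otimes> a"
      unfolding ac[symmetric] using a c by (simp add: m_assoc)
    finally show "inv c \<in> ?C" using c by simp
  next
    fix c d assume "c \<in> ?C" "d \<in> ?C"
    then have "a \<otimes> (c \<otimes> d) = c \<otimes> a \<otimes> d" using a by (simp flip: m_assoc)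
    also have "\<dots> = c \<otimes> d \<otimes> a" using a \<open>c \<in> ?C\<close> \<open>d \<in> ?C\<close> by (simp add: m_assoc)
    finally show "c \<otimes> d \<in> ?C" using \<open>c \<in> ?C\<close> \<open>d \<in> ?C\<close> by simp
  qed (use a in auto)
  then have "card ?C dvd order G"
    using lagrange[of ?C] dvd_triv_right[of "card ?C" "card (rcosets ?C)"] by simp
  have fin: "finite (carrier G)"
    using prime_gt_0_nat[OF assms(1)] by (simp add: order_def card_gt_0_iff)
  have "card {\<one>, a} \<le> card ?C"
    using a fin by (intro card_mono) auto
  then have "card ?C \<noteq> 1" using False by simp
  then have "card ?C = card (carrier G)"
    using \<open>card ?C dvd order G\<close> assms(1) unfolding prime_nat_iff order_def by blast
  then have "?C = carrier G" using fin by (intro card_subset_eq) auto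
  then show ?thesis using b by auto
qed (use b in simp)

section \<open>The group of automorphisms of a ring\<close>

context ring
begin

text \<open>Elements of the group are extensional functions, so automorphisms agreeing on the
  carrier are equal. For this reason maps are restricted before they are taken as group
  elements.\<close>

lemma mem_ring_aut_group:
  "a \<in> carrier (ring_aut_group R) \<longleftrightarrow>
    a \<in> ring_hom R R \<and> a \<in> extensional (carrier R) \<and> bij_betw a (carrier R) (carrier R)"
  by (auto simp: ring_aut_group_def Bij_def)

lemma ring_aut_group_is_group: "group (ring_aut_group R)"
proof -
  let ?B = "BijGroup (carrier R)" and ?A = "ring_hom R R \<inter> Bij (carrier R)"
  interpret B: group ?B by (rule group_BijGroup)
  have B: "carrier ?B = Bij (carrier R)" by (simp add: BijGroup_def)
  have "subgroup ?A ?B"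
  proof (rule B.subgroupI)
    show "?A \<subseteq> carrier ?B" using B by auto
    have "(\<lambda>x\<in>carrier R. x) \<in> ?A"
      using id_Bij by (auto intro!: ring_hom_memI)
    then show "?A \<noteq> {}" by blast
  next
    fix a assume a: "a \<in> ?A"
    then have "a \<in> ring_iso R R" by (auto simp: ring_iso_def Bij_def)
    then have "inv_into (carrier R) a \<in> ring_hom R R"
      using ring_iso_set_sym ring_axioms by (auto simp: ring_iso_def)
    then have "restrict (inv_into (carrier R) a) (carrier R) \<in> ring_hom R R"
      by (auto simp: ring_hom_def)
    then show "inv\<^bsub>?B\<^esub> a \<in> ?A"
      using a by (simp add: inv_BijGroup restrict_inv_into_Bij)
  next
    fix a b assume a: "a \<in> ?A" and b: "b \<in> ?A"
    then have "compose (carrier R) a b \<in> ring_hom R R"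
      using a b by (auto intro!: ring_hom_memI simp: compose_def ring_hom_closed
          ring_hom_mult[of _ R R] ring_hom_add[of _ R R] ring_hom_one[of _ R R])
    then show "a \<otimes>\<^bsub>?B\<^esub> b \<in> ?A"
      using a b compose_Bij by (auto simp: BijGroup_def)
  qed
  then show ?thesis
    unfolding ring_aut_group_def by (rule subgroup.subgroup_is_group[OF _ B.is_group])
qed

lemma ring_aut_group_apply:
  assumes "a \<in> carrier (ring_aut_group R)" "b \<in> carrier (ring_aut_group R)" "u \<in> carrier R"
  shows "(a \<otimes>\<^bsub>ring_aut_group R\<^esub> b) u = a (b u)"
  using assms by (simp add: ring_aut_group_def BijGroup_def compose_def)

lemma ring_aut_group_one: "u \<in> carrier R \<Longrightarrow> \<one>\<^bsub>ring_aut_group R\<^esub> u = u"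
  by (simp add: ring_aut_group_def BijGroup_def)

lemma ring_aut_group_closed:
  "a \<in> carrier (ring_aut_group R) \<Longrightarrow> u \<in> carrier R \<Longrightarrow> a u \<in> carrier R"
  using ring_hom_closed by (fastforce simp: mem_ring_aut_group)

lemma ring_aut_group_inv:
  assumes a: "a \<in> carrier (ring_aut_group R)" and u: "u \<in> carrier R"
  shows "(inv\<^bsub>ring_aut_group R\<^esub> a) (a u) = u" "a ((inv\<^bsub>ring_aut_group R\<^esub> a) u) = u"
proof -
  interpret A: group "ring_aut_group R" by (rule ring_aut_group_is_group)
  show "(inv\<^bsub>ring_aut_group R\<^esub> a) (a u) = u"
    using ring_aut_group_apply[OF A.inv_closed[OF a] a u] ring_aut_group_one[OF u] a by simp
  show "a ((inv\<^bsub>ring_aut_group R\<^esub> a) u) = u"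
    using ring_aut_group_apply[OF a A.inv_closed[OF a] u] ring_aut_group_one[OF u] a by simp
qed

end

context field
begin

lemma univ_poly_nat_pow: "p [^]\<^bsub>F[X]\<^esub> (n :: nat) = p [^]\<^bsub>poly_ring R\<^esub> n"
  by (induction n) (simp_all add: univ_poly_one univ_poly_mult)

text \<open>Writing p as (X - y)^n r and applying t, which fixes p, exhibits (X - t y)^n as a factor
  of p. Used for an automorphism and its inverse, the inequality becomes an equality.\<close>

lemma alg_mult_le_of_hom:
  assumes E: "subfield E R" and t: "t \<in> ring_hom (R\<lparr>carrier := E\<rparr>) (R\<lparr>carrier := E\<rparr>)"
    and p: "p \<in> carrier (E[X])" "map t p = p" and y: "y \<in> E"
  shows "alg_mult p y \<le> alg_mult p (t y)"
proof (cases "p = []")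
  case False
  have Ering: "subring E R" using subfieldE(1)[OF E] .
  have E_sub: "E \<subseteq> carrier R" using subfieldE(3)[OF E] .
  have Efield: "field (R\<lparr>carrier := E\<rparr>)" using subfield_iff(2)[OF E] .
  interpret UP: domain "E[X]" using univ_poly_is_domain[OF Ering] .
  have EX: "poly_ring (R\<lparr>carrier := E\<rparr>) = E[X]" using univ_poly_consistent[OF Ering] by simp
  interpret t: ring_hom_ring "R\<lparr>carrier := E\<rparr>" "R\<lparr>carrier := E\<rparr>" t
    using fieldE(1)[OF Efield] t by (auto intro!: ring_hom_ringI2 cring.axioms)
  note tX = map_poly_hom[OF Efield Efield t, unfolded EX]
  interpret tX: ring_hom_cring "E[X]" "E[X]" "map t"
    using tX UP.is_cring by (simp add: ring_hom_cring_def ring_hom_cring_axioms_def)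
  \<comment> \<open>The linear factor is written with the minus of the ambient field, whereas t
    respects the minus of the structure with carrier E.\<close>
  have minus: "\<ominus>\<^bsub>R\<lparr>carrier := E\<rparr>\<^esub> u = \<ominus> u" if "u \<in> E" for u
  proof (rule minus_equality[symmetric])
    show "(\<ominus>\<^bsub>R\<lparr>carrier := E\<rparr>\<^esub> u) \<oplus> u = \<zero>"
      using t.R.l_neg[of u] that by simp
    show "u \<in> carrier R" "\<ominus>\<^bsub>R\<lparr>carrier := E\<rparr>\<^esub> u \<in> carrier R"
      using t.R.a_inv_closed[of u] that E_sub by auto
  qed
  let ?n = "alg_mult p y"
  have ty: "t y \<in> E" using ring_hom_closed[OF t] y by simp
  have lin: "[\<one>, \<ominus> u] \<in> carrier (E[X])" if "u \<in> E" for u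
    using that subringE(3,5)[OF Ering] by (simp add: univ_poly_carrier[symmetric] polynomial_def)
  have "map t [\<one>, \<ominus> y] = [\<one>, \<ominus> t y]"
    using t.hom_a_inv[of y] y minus[OF y] minus[OF ty] t.hom_one by simp
  then have pow: "map t ([\<one>, \<ominus> y] [^]\<^bsub>E[X]\<^esub> ?n) = [\<one>, \<ominus> t y] [^]\<^bsub>E[X]\<^esub> ?n"
    using tX.hom_pow[OF lin[OF y], of ?n] by simp
  have yR: "y \<in> carrier R" "t y \<in> carrier R" using y ty E_sub by auto
  have pR: "p \<in> carrier (poly_ring R)" using carrier_polynomial_shell[OF Ering p(1)] .
  have "([\<one>, \<ominus> y] [^]\<^bsub>E[X]\<^esub> ?n) pdivides p"
    using alg_multE(1)[OF yR(1) pR False] unfolding univ_poly_nat_pow[of E] .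
  then have "([\<one>, \<ominus> y] [^]\<^bsub>E[X]\<^esub> ?n) divides\<^bsub>E[X]\<^esub> p"
    using pdivides_iff_shell[OF E _ p(1)] lin[OF y] by simp
  then obtain r where r: "r \<in> carrier (E[X])" "p = ([\<one>, \<ominus> y] [^]\<^bsub>E[X]\<^esub> ?n) \<otimes>\<^bsub>E[X]\<^esub> r"
    unfolding factor_def by blast
  have "p = ([\<one>, \<ominus> t y] [^]\<^bsub>E[X]\<^esub> ?n) \<otimes>\<^bsub>E[X]\<^esub> map t r"
    using tX.hom_mult[of "[\<one>, \<ominus> y] [^]\<^bsub>E[X]\<^esub> ?n" r] r lin[OF y] p(2) pow by simp
  then have "([\<one>, \<ominus> t y] [^]\<^bsub>E[X]\<^esub> ?n) divides\<^bsub>E[X]\<^esub> p"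
    using tX.hom_closed[OF r(1)] unfolding factor_def by blast
  then have "([\<one>, \<ominus> t y] [^]\<^bsub>E[X]\<^esub> ?n) pdivides p"
    using pdivides_iff_shell[OF E _ p(1)] lin[OF ty] by simp
  then show ?thesis
    using alg_multE(2)[OF yR(2) pR False] unfolding univ_poly_nat_pow[of E] by blast
qed (simp add: alg_mult_def)

end

text \<open>An automorphism of F is lifted by sending a generator x of E to a root y of the
  conjugated minimal polynomial. The field F(y) has degree q too, so uniqueness gives F(y) = E and
  the lift is an automorphism of E. The chosen lifts are then corrected to a homomorphism by
  \<open>lift_hom_of_coprime\<close>.\<close>

lemma (in field) action_on_unique_extension:
  assumes G: "group G" "finite (carrier G)"
    and F: "subfield F R" and splits: "\<And>p. p \<in> carrier (F[X]) \<Longrightarrow> splitted p"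
    and s: "\<And>g. g \<in> carrier G \<Longrightarrow> s g \<in> ring_iso (R\<lparr>carrier := F\<rparr>) (R\<lparr>carrier := F\<rparr>)"
    and s_mult: "\<And>g g' k. g \<in> carrier G \<Longrightarrow> g' \<in> carrier G \<Longrightarrow> k \<in> F \<Longrightarrow>
      s (g \<otimes>\<^bsub>G\<^esub> g') k = s g (s g' k)"
    and q: "Factorial_Ring.prime q" "coprime q (card (carrier G))"
    and E: "subfield E R" "F \<subseteq> E" "dimension q F E"
    and unique: "\<And>E'. subfield E' R \<Longrightarrow> F \<subseteq> E' \<Longrightarrow> dimension q F E' \<Longrightarrow> E' = E"
  obtains T where "T \<in> hom G (ring_aut_group (R\<lparr>carrier := E\<rparr>))"
    and "\<And>g k. g \<in> carrier G \<Longrightarrow> k \<in> F \<Longrightarrow> T g k = s g k"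
proof -
  let ?F = "R\<lparr>carrier := F\<rparr>" and ?E = "R\<lparr>carrier := E\<rparr>"
  let ?H = "ring_aut_group ?E"
  interpret G: group G by fact
  have Ffield: "field ?F" and Efield: "field ?E" using subfield_iff(2) F E(1) by auto
  have Fring: "subring F R" and Ering: "subring E R" using subfieldE(1) F E(1) by auto
  have F_sub: "F \<subseteq> carrier R" and E_sub: "E \<subseteq> carrier R" using subfieldE(3) F E(1) by auto
  have FX: "poly_ring ?F = F[X]" using univ_poly_consistent[OF Fring] by simp
  interpret ER: ring ?E using subring_is_ring[OF Ering] .
  interpret H: group ?H by (rule ER.ring_aut_group_is_group)
  note H_apply = ER.ring_aut_group_apply[simplified] and H_one = ER.ring_aut_group_one[simplified]
    and H_closed = ER.ring_aut_group_closed[simplified] and H_inv = ER.ring_aut_group_inv[simplified]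
    and H_mem = ER.mem_ring_aut_group[simplified]
  have H_hom: "a \<in> ring_hom ?E R" if "a \<in> carrier ?H" for a
    using that E_sub by (auto simp: H_mem ring_hom_def)

  have "F \<noteq> E"
    using dimension_is_inj[OF F, of 1 F q] dimension_one[OF F] q(1) E(3) by auto
  then obtain x where x: "x \<in> E" "x \<notin> F" using E(2) by blast
  have xR: "x \<in> carrier R" using x E_sub by auto
  note Fx = simple_extension_of_prime_degree[OF F E(1,2) q(1) E(3) x]
  define p where "p = Irr F x"
  have p: "p \<in> carrier (F[X])" "pirreducible F p" "eval p x = \<zero>" and deg: "degree p = q"
    using IrrE[OF F xR Fx(2)] Fx(3) by (simp_all add: p_def)
  have p_set: "set p \<subseteq> F" using p(1) by (auto simp: univ_poly_carrier[symmetric] polynomial_def)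
  have pR: "p \<in> carrier (poly_ring R)" using carrier_polynomial_shell[OF Fring p(1)] .

  have ext: "\<exists>a\<in>carrier ?H. (\<forall>k\<in>F. a k = i k) \<and> a x = y"
    if i: "i \<in> ring_iso ?F ?F" and y: "y \<in> carrier R" "eval (map i p) y = \<zero>" for i y
  proof -
    have i_hom: "i \<in> ring_hom ?F ?F" using i by (simp add: ring_iso_def)
    have ip: "map i p \<in> carrier (F[X])" "pirreducible F (map i p)"
      using ring_hom_closed[OF map_poly_hom[OF Ffield Ffield i_hom]]
        pirreducible_map[OF Ffield Ffield i] p unfolding FX by auto
    have Fy: "simple_extension F y = E"
      using unique[OF _ simple_extension_incl[OF F_sub y(1)]]
        dimension_simple_extension'[OF F ip y] deg by simp
    obtain a where a: "a \<in> ring_hom (R\<lparr>carrier := simple_extension F x\<rparr>) R"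
      "\<And>k. k \<in> F \<Longrightarrow> a k = i k" "a x = y"
      and a_eval: "\<And>r. r \<in> carrier (F[X]) \<Longrightarrow> a (eval r x) = eval (map i r) y"
      using extend_hom_simple_extension[OF F i_hom p(1,2) xR p(3) y] by blast
    note a_hom = a(1)[unfolded Fx(1)]
    have img_x: "E = (\<lambda>r. eval r x) ` carrier (F[X])"
      using simple_extension_as_eval_img[OF F_sub xR] Fx(1) by simp
    have img_y: "E = (\<lambda>r. eval r y) ` carrier (F[X])"
      using simple_extension_as_eval_img[OF F_sub y(1)] Fy by simp
    \<comment> \<open>The lift sends r(x) to i(r)(y). As i permutes F, the polynomials i(r) run
      through all of F[X], so the image is F(y) = E.\<close>
    have "a ` E = (\<lambda>r. eval (map i r) y) ` carrier (F[X])"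
      unfolding img_x image_image using a_eval by (intro image_cong) auto
    also have "\<dots> = (\<lambda>r. eval r y) ` (map i ` carrier (F[X]))"
      by (simp add: image_image)
    also have "map i ` carrier (F[X]) = carrier (F[X])"
    proof
      show "map i ` carrier (F[X]) \<subseteq> carrier (F[X])"
        using ring_hom_closed[OF map_poly_hom[OF Ffield Ffield i_hom]] unfolding FX by blast
      let ?j = "inv_into F i"
      have "ring ?F" using subring_is_ring[OF Fring] .
      then have "?j \<in> ring_hom ?F ?F"
        using ring_iso_set_sym[of ?F i ?F] i by (simp add: ring_iso_def)
      note jX = ring_hom_closed[OF map_poly_hom[OF Ffield Ffield this], unfolded FX]
      have ij: "i (?j k) = k" if "k \<in> F" for k
        using that i by (simp add: ring_iso_def bij_betw_def f_inv_into_f)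
      show "carrier (F[X]) \<subseteq> map i ` carrier (F[X])"
      proof
        fix r assume r: "r \<in> carrier (F[X])"
        then have "set r \<subseteq> F" by (auto simp: univ_poly_carrier[symmetric] polynomial_def)
        then have "map i (map ?j r) = r" using ij by (induction r) auto
        then show "r \<in> map i ` carrier (F[X])" using jX[OF r] by (metis imageI)
      qed
    qed
    finally have aE: "a ` E = E" using img_y by simp
    moreover have "inj_on a E"
      using non_trivial_field_hom_is_inj[OF a_hom Efield field_axioms] by simp
    ultimately have "bij_betw (restrict a E) E E" by (simp add: bij_betw_def)
    moreover have "restrict a E \<in> ring_hom ?E ?E"
    proof (rule ring_hom_memI)
      fix u v assume "u \<in> carrier ?E" "v \<in> carrier ?E"
      moreover from this have "u \<otimes> v \<in> E" "u \<oplus> v \<in> E" using subringE(6,7)[OF Ering] by auto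
      ultimately show "restrict a E u \<in> carrier ?E"
        "restrict a E (u \<otimes>\<^bsub>?E\<^esub> v) = restrict a E u \<otimes>\<^bsub>?E\<^esub> restrict a E v"
        "restrict a E (u \<oplus>\<^bsub>?E\<^esub> v) = restrict a E u \<oplus>\<^bsub>?E\<^esub> restrict a E v"
        using aE ring_hom_mult[OF a_hom, of u v] ring_hom_add[OF a_hom, of u v] by auto
    next
      show "restrict a E \<one>\<^bsub>?E\<^esub> = \<one>\<^bsub>?E\<^esub>"
        using ring_hom_one[OF a_hom] subringE(3)[OF Ering] by simp
    qed
    ultimately have "restrict a E \<in> carrier ?H" by (simp add: H_mem)
    moreover have "restrict a E k = i k" if "k \<in> F" for k using that a(2) E(2) by auto
    moreover have "restrict a E x = y" using x a(3) by simp
    ultimately show ?thesis by blast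
  qed

  define N where "N = {n \<in> carrier ?H. \<forall>k\<in>F. n k = k}"
  have N: "subgroup N ?H"
  proof (rule H.subgroupI)
    show "N \<subseteq> carrier ?H" by (auto simp: N_def)
    show "N \<noteq> {}" using E(2) H_one by (force simp: N_def)
  next
    fix a assume a: "a \<in> N"
    have "(inv\<^bsub>?H\<^esub> a) k = k" if "k \<in> F" for k
      using H_inv(1)[of a k] a that E(2) by (auto simp: N_def)
    then show "inv\<^bsub>?H\<^esub> a \<in> N" using a by (simp add: N_def)
  next
    fix a b assume "a \<in> N" "b \<in> N"
    then show "a \<otimes>\<^bsub>?H\<^esub> b \<in> N" using E(2) by (auto simp: N_def H_apply)
  qed
  \<comment> \<open>An automorphism over F is determined by the image of x, and \<open>ext\<close>,
    applied to the identity of F, realises every root of p.\<close>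
  have bij: "bij_betw (\<lambda>n. n x) N (set_mset (roots p))"
  proof (rule bij_betwI')
    fix a b assume "a \<in> N" "b \<in> N"
    then have a: "a \<in> carrier ?H" "\<And>k. k \<in> F \<Longrightarrow> a k = k"
      and b: "b \<in> carrier ?H" "\<And>k. k \<in> F \<Longrightarrow> b k = k" by (auto simp: N_def)
    show "(a x = b x) = (a = b)"
    proof
      assume "a x = b x"
      have "a u = b u" if "u \<in> E" for u
        using \<open>a x = b x\<close> that a(2) b(2)
        by - (rule hom_simple_extension_unique[OF F xR, unfolded Fx(1), OF H_hom[OF a(1)]
              H_hom[OF b(1)]], auto)
      then show "a = b"
        using a(1) b(1) by (intro extensionalityI[of a E b]) (auto simp: H_mem)
    qed simp
  next
    fix n assume "n \<in> N"
    then have n: "n \<in> carrier ?H" "\<And>k. k \<in> F \<Longrightarrow> n k = k" by (auto simp: N_def)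
    interpret n: ring_hom_ring ?E R n
      using ER.ring_axioms ring_axioms H_hom[OF n(1)] by (rule ring_hom_ringI2)
    have "map n p = p" using p_set n(2) by (simp add: map_idI subset_iff)
    then have "eval p (n x) = n (eval p x)"
      using n.eval_hom'[of x p] x p_set E(2) eval_consistent[OF Ering] by auto
    also have "\<dots> = \<zero>" using p(3) n.hom_zero by simp
    finally show "n x \<in> set_mset (roots p)"
      using roots_mem_iff_is_root[OF pR] H_closed[OF n(1) x(1)] E_sub
        pirreducibleE(1)[OF Fring p(1,2)] by (auto simp: is_root_def)
  next
    fix y assume "y \<in> set_mset (roots p)"
    then have y: "y \<in> carrier R" "eval p y = \<zero>"
      using roots_mem_iff_is_root[OF pR] by (auto simp: is_root_def)
    have "(\<lambda>k. k) \<in> ring_iso ?F ?F" by (auto simp: ring_iso_def ring_hom_def bij_betw_def)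
    from ext[OF this y(1)] y(2) show "\<exists>n\<in>N. y = n x" by (auto simp: N_def)
  qed
  \<comment> \<open>The polynomial \<open>p\<close> may be inseparable; but \<open>N\<close> acts transitively on its roots, so they all have
    the same multiplicity and their number divides \<open>q\<close>.\<close>
  have mult_eq: "count (roots p) y = count (roots p) x" if y: "y \<in># roots p" for y
  proof -
    obtain n where n: "n \<in> N" "y = n x" using bij y by (auto simp: bij_betw_def)
    have pE: "p \<in> carrier (E[X])"
      using p(1) E(2) by (auto simp: univ_poly_carrier[symmetric] polynomial_def)
    have le: "alg_mult p u \<le> alg_mult p (a u)" if a: "a \<in> N" and u: "u \<in> E" for a u
    proof (rule alg_mult_le_of_hom[OF E(1) _ pE _ u])
      show "a \<in> ring_hom ?E ?E" using a by (simp add: N_def H_mem)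
      show "map a p = p" using a p_set by (auto simp: N_def intro: map_idI)
    qed
    have "(inv\<^bsub>?H\<^esub> n) y = x" using n x by (simp add: N_def H_inv)
    moreover have "y \<in> E" using n x by (simp add: N_def H_closed)
    ultimately show ?thesis
      using le[OF n(1) x(1)] le[OF subgroup.m_inv_closed[OF N n(1)], of y] n(2)
      unfolding alg_mult_eq_count_roots[OF pR] by simp
  qed
  have "q = size (roots p)" using splits[OF p(1)] deg by (simp add: splitted_def)
  also have "\<dots> = (\<Sum>y\<in>set_mset (roots p). count (roots p) x)"
    unfolding size_multiset_overloaded_eq using mult_eq by (intro sum.cong) auto
  also have "\<dots> = card N * count (roots p) x" using bij_betw_same_card[OF bij] by simp
  finally have card_N: "card N dvd q" by simp
  then have "finite N" using q(1) card_eq_0_iff by (metis dvd_0_left_iff not_prime_0)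
  have coprime: "coprime (card N) (card (carrier G))" using coprime_divisors[OF card_N dvd_refl q(2)] .
  have N_comm: "a \<otimes>\<^bsub>?H\<^esub> b = b \<otimes>\<^bsub>?H\<^esub> a" if ab: "a \<in> N" "b \<in> N" for a b
  proof (cases "card N = 1")
    case True
    then obtain n where "N = {n}" by (rule card_1_singletonE)
    then show ?thesis using ab by simp
  next
    case False
    then have "card N = q" using card_N q(1) unfolding prime_nat_iff by blast
    then show ?thesis
      using group.prime_order_imp_comm[OF subgroup.subgroup_is_group[OF N H.is_group], of a b] ab q(1)
      by (simp add: order_def)
  qed

  have "\<exists>a. a \<in> carrier ?H \<and> (\<forall>k\<in>F. a k = s g k)" if g: "g \<in> carrier G" for g
  proof -
    have "s g \<in> ring_hom ?F ?F" using s[OF g] by (simp add: ring_iso_def)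
    then have sp: "map (s g) p \<in> carrier (F[X])"
      using ring_hom_closed[OF map_poly_hom[OF Ffield Ffield]] p(1) unfolding FX by blast
    then have "size (roots (map (s g) p)) = q" using splits deg by (simp add: splitted_def)
    then have "roots (map (s g) p) \<noteq> {#}" using q(1) by auto
    then obtain y where "y \<in># roots (map (s g) p)" by blast
    then have "y \<in> carrier R" "eval (map (s g) p) y = \<zero>"
      using roots_mem_iff_is_root[OF carrier_polynomial_shell[OF Fring sp]] by (auto simp: is_root_def)
    from ext[OF s[OF g] this] show ?thesis by blast
  qed
  then obtain l where l: "\<And>g. g \<in> carrier G \<Longrightarrow> l g \<in> carrier ?H"
    and lF: "\<And>g k. g \<in> carrier G \<Longrightarrow> k \<in> F \<Longrightarrow> l g k = s g k" by metis
  have sF: "s g k \<in> F" if "g \<in> carrier G" "k \<in> F" for g k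
    using ring_hom_closed[of "s g" ?F ?F k] s[OF that(1)] that(2) by (simp add: ring_iso_def)
  have s_inv: "\<exists>k'\<in>F. k = s g k'" if "g \<in> carrier G" "k \<in> F" for g k
    using s[OF that(1)] that(2) by (auto simp: ring_iso_def bij_betw_def)
  \<comment> \<open>Each l_g maps F onto itself, so conjugation by it preserves the automorphisms
    that fix F pointwise.\<close>
  have conj: "l g \<otimes>\<^bsub>?H\<^esub> n \<otimes>\<^bsub>?H\<^esub> inv\<^bsub>?H\<^esub> (l g) \<in> N" if g: "g \<in> carrier G" and n: "n \<in> N" for g n
  proof -
    have nH: "n \<in> carrier ?H" using n by (simp add: N_def)
    have "(l g \<otimes>\<^bsub>?H\<^esub> n \<otimes>\<^bsub>?H\<^esub> inv\<^bsub>?H\<^esub> (l g)) k = k" if k: "k \<in> F" for k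
    proof -
      obtain k' where k': "k' \<in> F" "l g k' = k" using s_inv[OF g k] lF[OF g] by auto
      have kE: "k \<in> E" "k' \<in> E" using k k'(1) E(2) by auto
      have "(inv\<^bsub>?H\<^esub> (l g)) k = k'"
        using H_inv(1)[OF l[OF g] kE(2)] k'(2) by simp
      moreover have "n k' = k'" using n k'(1) by (simp add: N_def)
      ultimately show ?thesis
        using H_apply[of "l g \<otimes>\<^bsub>?H\<^esub> n" "inv\<^bsub>?H\<^esub> (l g)" k] H_apply[of "l g" n k'] l[OF g] nH kE k'(2)
        by simp
    qed
    then show ?thesis using l[OF g] nH by (simp add: N_def)
  qed
  \<comment> \<open>On F, both the composite of the two lifts and the lift of the product restrict
    to s_(gg'), so they differ by an automorphism over F.\<close>
  have cocycle: "l g \<otimes>\<^bsub>?H\<^esub> l g' \<otimes>\<^bsub>?H\<^esub> inv\<^bsub>?H\<^esub> (l (g \<otimes>\<^bsub>G\<^esub> g')) \<in> N"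
    if g: "g \<in> carrier G" and g': "g' \<in> carrier G" for g g'
  proof -
    let ?gg = "g \<otimes>\<^bsub>G\<^esub> g'"
    have gg: "?gg \<in> carrier G" using g g' by simp
    have "(l g \<otimes>\<^bsub>?H\<^esub> l g' \<otimes>\<^bsub>?H\<^esub> inv\<^bsub>?H\<^esub> (l ?gg)) k = k" if k: "k \<in> F" for k
    proof -
      obtain k' where k': "k' \<in> F" "l ?gg k' = k" using s_inv[OF gg k] lF[OF gg] by auto
      have kE: "k \<in> E" "k' \<in> E" using k k'(1) E(2) by auto
      have "(inv\<^bsub>?H\<^esub> (l ?gg)) k = k'"
        using H_inv(1)[OF l[OF gg] kE(2)] k'(2) by simp
      then have "(l g \<otimes>\<^bsub>?H\<^esub> l g' \<otimes>\<^bsub>?H\<^esub> inv\<^bsub>?H\<^esub> (l ?gg)) k = l g (l g' k')"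
        using H_apply[of "l g \<otimes>\<^bsub>?H\<^esub> l g'" "inv\<^bsub>?H\<^esub> (l ?gg)" k] H_apply[of "l g" "l g'" k']
          l[OF g] l[OF g'] l[OF gg] kE by simp
      also have "\<dots> = k"
        using lF[OF g sF[OF g' k'(1)]] lF[OF g' k'(1)] s_mult[OF g g' k'(1)] lF[OF gg k'(1)] k'(2)
        by simp
      finally show ?thesis .
    qed
    then show ?thesis using l g g' by (simp add: N_def)
  qed
  obtain T where T: "T \<in> hom G ?H" "\<And>g. g \<in> carrier G \<Longrightarrow> \<exists>n\<in>N. T g = n \<otimes>\<^bsub>?H\<^esub> l g"
    using H.lift_hom_of_coprime[OF G N \<open>finite N\<close> coprime N_comm l conj cocycle] by blast
  show thesis
  proof (rule that[OF T(1)])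
    fix g k assume g: "g \<in> carrier G" and k: "k \<in> F"
    obtain n where n: "n \<in> N" "T g = n \<otimes>\<^bsub>?H\<^esub> l g" using T(2)[OF g] by blast
    then have "T g k = n (l g k)"
      using H_apply[of n "l g" k] l[OF g] k E(2) by (auto simp: N_def)
    then show "T g k = s g k"
      using n(1) lF[OF g k] sF[OF g k] by (simp add: N_def)
  qed
qed

section \<open>Irreducible polynomials over models\<close>

lemma (in field) pirreducible_root_in_base:
  assumes F: "subfield F R" and p: "p \<in> carrier (F[X])" "pirreducible F p"
    and a: "a \<in> F" "eval p a = \<zero>"
  shows "degree p = 1"
proof -
  have aR: "a \<in> carrier R" using a subfieldE(3)[OF F] by blast
  have "simple_extension F a = F"
    using simple_extension_subring_incl[OF subfieldE(1)[OF F] order_refl a(1)]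
      simple_extension_incl[OF subfieldE(3)[OF F] aR] by blast
  then show ?thesis
    using dimension_simple_extension'(1)[OF F p aR a(2)] dimension_one[OF F]
      dimension_is_inj[OF F] by fastforce
qed

text \<open>This is the form in which the axioms are contradicted: the irreducible polynomial of x
  acquires a root in K and is therefore linear. Its coefficients lie in the image of K, so it is
  first pulled back to a list over K.\<close>

lemma (in transformal) no_transformal_extension:
  fixes A :: "('l, 'd) ring_scheme"
  assumes TCF: "TCF_model G K \<sigma>"
    and A: "field A" and \<iota>: "\<iota> \<in> ring_hom K A"
    and E: "subfield E A" "\<iota> ` carrier K \<subseteq> E"
    and T: "\<And>g. g \<in> carrier G \<Longrightarrow> T g \<in> ring_hom (A\<lparr>carrier := E\<rparr>) (A\<lparr>carrier := E\<rparr>)"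
    and T\<iota>: "\<And>g a. g \<in> carrier G \<Longrightarrow> a \<in> carrier K \<Longrightarrow> T g (\<iota> a) = \<iota> (\<sigma> g a)"
    and x: "x \<in> E" "T \<one>\<^bsub>G\<^esub> x = x"
    and T_mult: "\<And>g g'. g \<in> carrier G \<Longrightarrow> g' \<in> carrier G \<Longrightarrow>
      T (g \<otimes>\<^bsub>G\<^esub> g') x = T g (T g' x)"
    and p: "p \<in> carrier (univ_poly A (\<iota> ` carrier K))" "pirreducible\<^bsub>A\<^esub> (\<iota> ` carrier K) p"
      "ring.eval A p x = \<zero>\<^bsub>A\<^esub>"
  shows "degree p = 1"
proof -
  interpret A: field A by fact
  interpret \<iota>: ring_hom_ring K A \<iota>
    using K.ring_axioms A.ring_axioms \<iota> by (rule ring_hom_ringI2)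
  have F: "subfield (\<iota> ` carrier K) A"
    using \<iota>.img_is_subfield(2)[OF K.carrier_is_subfield] by simp
  have "set p \<subseteq> \<iota> ` carrier K"
    using p(1) by (auto simp: univ_poly_carrier[symmetric] polynomial_def)
  then have "map \<iota> (map (inv_into (carrier K) \<iota>) p) = p"
    and "set (map (inv_into (carrier K) \<iota>) p) \<subseteq> carrier K"
    by (auto simp: f_inv_into_f inv_into_into subset_iff map_idI)
  then obtain p0 where p0: "set p0 \<subseteq> carrier K" "p = map \<iota> p0"
    by metis
  have Efield: "field (A\<lparr>carrier := E\<rparr>)" using A.subfield_iff(2)[OF E(1)] .
  have \<iota>E: "\<iota> \<in> ring_hom K (A\<lparr>carrier := E\<rparr>)"
    using \<iota> E(2) by (auto simp: ring_hom_def)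
  have eval: "ring.eval (A\<lparr>carrier := E\<rparr>) (map \<iota> p0) x = \<zero>\<^bsub>A\<lparr>carrier := E\<rparr>\<^esub>"
    using p(3) p0(2) A.eval_consistent[OF subfieldE(1)[OF E(1)]] by simp
  have xE: "x \<in> carrier (A\<lparr>carrier := E\<rparr>)" using x(1) by simp
  obtain a where a: "a \<in> carrier K" "K.eval p0 a = \<zero>\<^bsub>K\<^esub>"
    by (rule root_of_transformal_extension[OF TCF Efield \<iota>E T T\<iota> xE T_mult x(2) p0(1) eval])
  have "A.eval p (\<iota> a) = \<zero>\<^bsub>A\<^esub>"
    using \<iota>.eval_hom'[OF a(1) p0(1)] a(2) p0(2) by simp
  then show ?thesis
    using A.pirreducible_root_in_base[OF F p(1,2)] a(1) by blast
qed

section \<open>Products of polynomials and divisors of powers\<close>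

lemma (in domain) poly_ring_finprod_degree:
  assumes "finite I" "\<And>i. i \<in> I \<Longrightarrow> f i \<in> carrier (poly_ring R)" "\<And>i. i \<in> I \<Longrightarrow> f i \<noteq> []"
  shows "finprod (poly_ring R) f I \<noteq> []"
    and "degree (finprod (poly_ring R) f I) = (\<Sum>i\<in>I. degree (f i))"
proof -
  interpret UP: domain "poly_ring R" using univ_poly_is_domain[OF carrier_is_subring] .
  have "finprod (poly_ring R) f I \<noteq> [] \<and>
    degree (finprod (poly_ring R) f I) = (\<Sum>i\<in>I. degree (f i))"
    using assms
  proof (induction I)
    case (insert i I)
    let ?P = "finprod (poly_ring R) f I"
    have P: "?P \<in> carrier (poly_ring R)" using insert by (intro UP.finprod_closed) auto
    have eq: "finprod (poly_ring R) f (insert i I) = poly_mult (f i) ?P"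
      using insert by (subst UP.finprod_insert) (auto simp: univ_poly_mult)
    have ih: "?P \<noteq> []" "degree ?P = (\<Sum>i\<in>I. degree (f i))" and fi: "f i \<in> carrier (poly_ring R)" "f i \<noteq> []"
      using insert by auto
    have "poly_mult (f i) ?P \<noteq> []"
      using UP.integral[of "f i" ?P] fi ih P by (auto simp: univ_poly_mult univ_poly_zero)
    moreover have "degree (poly_mult (f i) ?P) = degree (f i) + degree ?P"
      using poly_mult_degree_eq[OF carrier_is_subring, of "f i" ?P] fi P ih
      by (simp add: univ_poly_carrier)
    ultimately show ?case using insert ih unfolding eq by simp
  qed (simp add: univ_poly_one)
  then show "finprod (poly_ring R) f I \<noteq> []"
    "degree (finprod (poly_ring R) f I) = (\<Sum>i\<in>I. degree (f i))" by auto
qed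

lemma (in cring) finprod_divides_pow:
  assumes "finite I" "\<And>i. i \<in> I \<Longrightarrow> f i \<in> carrier R" "b \<in> carrier R"
    and "\<And>i. i \<in> I \<Longrightarrow> f i divides b"
  shows "finprod R f I divides b [^] card I"
  using assms
proof (induction I)
  case (insert i I)
  obtain c where c: "c \<in> carrier R" "b = f i \<otimes> c" using insert.prems(3)[of i] by (auto simp: factor_def)
  obtain d where d: "d \<in> carrier R" "b [^] card I = finprod R f I \<otimes> d"
    using insert by (auto simp: factor_def)
  have P: "finprod R f I \<in> carrier R" using insert.prems by (intro finprod_closed) auto
  have "b [^] card (insert i I) = b [^] card I \<otimes> b"
    using insert.hyps by simp
  also have "\<dots> = (finprod R f I \<otimes> d) \<otimes> (f i \<otimes> c)" using c(2) d(2) by simp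
  also have "\<dots> = (f i \<otimes> finprod R f I) \<otimes> (d \<otimes> c)"
    using c(1) d(1) P insert.prems(1)[of i] by (simp add: m_ac)
  also have "f i \<otimes> finprod R f I = finprod R f (insert i I)"
    using insert.prems(1) insert.hyps by (subst finprod_insert) auto
  finally show ?case using c(1) d(1) by (auto simp: factor_def)
qed (simp add: factor_def)

text \<open>Up to a unit, P is a power of f. The induction strips one factor f at a time: f is prime
  in F[X], so it divides P or the cofactor and can be cancelled on both sides.\<close>

lemma (in domain) degree_dvd_of_divides_pow:
  assumes F: "subfield F R" and f: "f \<in> carrier (F[X])" "pirreducible F f"
    and P: "P \<in> carrier (F[X])" "P divides\<^bsub>F[X]\<^esub> (f [^]\<^bsub>F[X]\<^esub> (n :: nat))"
  shows "degree f dvd degree P"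
  using P
proof (induction n arbitrary: P)
  interpret UP: principal_domain "F[X]" using univ_poly_is_principal[OF F] .
  case 0
  then have "P \<in> Units (F[X])"
    using UP.Unit_eq_dividesone by simp
  then show ?case using univ_poly_units'[OF F, of P] by simp
next
  interpret UP: principal_domain "F[X]" using univ_poly_is_principal[OF F] .
  case (Suc n)
  have f0: "f \<noteq> []" using pirreducibleE(1)[OF subfieldE(1)[OF F] f] .
  then have f0': "f \<noteq> \<zero>\<^bsub>F[X]\<^esub>" by (simp add: univ_poly_zero)
  have prime: "pprime F f" using pprime_iff_pirreducible[OF F f(1)] f(2) by simp
  have fn: "f [^]\<^bsub>F[X]\<^esub> n \<in> carrier (F[X])" using f(1) by simp
  obtain r where r: "r \<in> carrier (F[X])" "f [^]\<^bsub>F[X]\<^esub> n \<otimes>\<^bsub>F[X]\<^esub> f = P \<otimes>\<^bsub>F[X]\<^esub> r"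
    using Suc.prems(2) by (auto simp: factor_def)
  have "P \<otimes>\<^bsub>F[X]\<^esub> r = f \<otimes>\<^bsub>F[X]\<^esub> f [^]\<^bsub>F[X]\<^esub> n"
    using r(2) UP.m_comm[OF fn f(1)] by simp
  then have "f divides\<^bsub>F[X]\<^esub> (P \<otimes>\<^bsub>F[X]\<^esub> r)"
    using fn by (auto simp: factor_def)
  then have "f pdivides (P \<otimes>\<^bsub>F[X]\<^esub> r)"
    using pdivides_iff_shell[OF F f(1) UP.m_closed[OF Suc.prems(1) r(1)]] by simp
  then consider "f pdivides P" | "f pdivides r"
    using pprimeE(3)[OF F f(1) prime Suc.prems(1) r(1)] by blast
  then show ?case
  proof cases
    case 1
    then obtain P' where P': "P' \<in> carrier (F[X])" "P = f \<otimes>\<^bsub>F[X]\<^esub> P'"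
      using pdivides_iff_shell[OF F f(1) Suc.prems(1)] by (auto simp: factor_def)
    have "f \<otimes>\<^bsub>F[X]\<^esub> f [^]\<^bsub>F[X]\<^esub> n = f \<otimes>\<^bsub>F[X]\<^esub> (P' \<otimes>\<^bsub>F[X]\<^esub> r)"
      using r P' f(1) fn by (simp add: UP.m_ac)
    then have "f [^]\<^bsub>F[X]\<^esub> n = P' \<otimes>\<^bsub>F[X]\<^esub> r"
      using UP.m_lcancel[OF f0' f(1) fn] P' r by simp
    then have "P' divides\<^bsub>F[X]\<^esub> f [^]\<^bsub>F[X]\<^esub> n" using r by (auto simp: factor_def)
    then have "degree f dvd degree P'" using Suc.IH P' by simp
    \<comment> \<open>The degree formula needs nonzero factors. If P' is zero, so is P, whose degree
      is 0 by convention and hence divisible by that of f.\<close>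
    moreover have "P' = [] \<or> degree P = degree f + degree P'"
      using poly_mult_degree_eq[OF subfieldE(1)[OF F], of f P'] f f0 P'
      by (simp add: univ_poly_carrier univ_poly_mult)
    moreover have "P = []" if "P' = []"
      using that P' f UP.r_null by (simp add: univ_poly_zero)
    ultimately show ?thesis by auto
  next
    case 2
    then obtain r' where r': "r' \<in> carrier (F[X])" "r = f \<otimes>\<^bsub>F[X]\<^esub> r'"
      using pdivides_iff_shell[OF F f(1) r(1)] by (auto simp: factor_def)
    have "f \<otimes>\<^bsub>F[X]\<^esub> f [^]\<^bsub>F[X]\<^esub> n = f \<otimes>\<^bsub>F[X]\<^esub> (P \<otimes>\<^bsub>F[X]\<^esub> r')"
      using r r' f(1) fn Suc.prems(1) by (simp add: UP.m_ac)
    then have "f [^]\<^bsub>F[X]\<^esub> n = P \<otimes>\<^bsub>F[X]\<^esub> r'"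
      using UP.m_lcancel[OF f0' f(1) fn] Suc.prems(1) r' by simp
    then have "P divides\<^bsub>F[X]\<^esub> f [^]\<^bsub>F[X]\<^esub> n" using r' by (auto simp: factor_def)
    then show ?thesis using Suc.IH Suc.prems(1) by simp
  qed
qed

section \<open>Irreducibility over the fixed field and over K\<close>

context transformal
begin

abbreviation fixed_set :: "'a set"
  where "fixed_set \<equiv> {a \<in> carrier K. \<forall>g \<in> carrier G. \<sigma> g a = a}"

lemma fixed_set_subfield: "subfield fixed_set K"
proof (rule K.subfieldI'[OF K.subringI])
  show "\<one>\<^bsub>K\<^esub> \<in> fixed_set" using ring_hom_one \<sigma>_ring_hom by auto
next
  fix a assume "a \<in> fixed_set"
  then show "\<ominus>\<^bsub>K\<^esub> a \<in> fixed_set"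
    using ring_hom_cring.hom_a_inv[OF \<sigma>_hom_cring] by auto
next
  fix a b assume "a \<in> fixed_set" "b \<in> fixed_set"
  then show "a \<otimes>\<^bsub>K\<^esub> b \<in> fixed_set" "a \<oplus>\<^bsub>K\<^esub> b \<in> fixed_set"
    using ring_hom_mult[OF \<sigma>_ring_hom] ring_hom_add[OF \<sigma>_ring_hom] by auto
next
  fix a assume a: "a \<in> fixed_set - {\<zero>\<^bsub>K\<^esub>}"
  then have aK: "a \<in> carrier K" and inv: "inv\<^bsub>K\<^esub> a \<in> carrier K" "a \<otimes>\<^bsub>K\<^esub> inv\<^bsub>K\<^esub> a = \<one>\<^bsub>K\<^esub>"
    using K.field_Units by auto
  have "\<sigma> g (inv\<^bsub>K\<^esub> a) = inv\<^bsub>K\<^esub> a" if g: "g \<in> carrier G" for g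
  proof -
    have "a \<otimes>\<^bsub>K\<^esub> \<sigma> g (inv\<^bsub>K\<^esub> a) = \<sigma> g (a \<otimes>\<^bsub>K\<^esub> inv\<^bsub>K\<^esub> a)"
      using ring_hom_mult[OF \<sigma>_ring_hom[OF g] aK inv(1)] a g by simp
    also have "\<dots> = a \<otimes>\<^bsub>K\<^esub> inv\<^bsub>K\<^esub> a"
      using inv(2) ring_hom_one[OF \<sigma>_ring_hom[OF g]] by simp
    finally show ?thesis
      using K.m_lcancel[of a] a aK inv(1) \<sigma>_closed[OF g inv(1)] by simp
  qed
  then show "inv\<^bsub>K\<^esub> a \<in> fixed_set" using inv by simp
qed auto

lemma pirreducible_of_fixed_set:
  assumes G: "finite (carrier G)"
    and f: "f \<in> carrier (univ_poly K fixed_set)" "pirreducible\<^bsub>K\<^esub> fixed_set f"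
    and q: "Factorial_Ring.prime (degree f)" "coprime (degree f) (card (carrier G))"
  shows "pirreducible\<^bsub>K\<^esub> (carrier K) f"
proof -
  let ?U = "poly_ring K"
  interpret UP: principal_domain ?U using K.univ_poly_is_principal[OF K.carrier_is_subfield] .
  note C = fixed_set_subfield
  have fK: "f \<in> carrier ?U" using K.carrier_polynomial_shell[OF subfieldE(1)[OF C] f(1)] .
  have f0: "f \<noteq> []" using q(1) by auto
  have f_fixed: "map (\<sigma> g) f = f" if "g \<in> carrier G" for g
    using f(1) that by (auto simp: univ_poly_carrier[symmetric] polynomial_def intro: map_idI)
  have \<sigma>X: "map (\<sigma> g) \<in> ring_hom ?U ?U" if "g \<in> carrier G" for g
    using map_poly_hom[OF K.field_axioms K.field_axioms \<sigma>_ring_hom[OF that]] .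
  \<comment> \<open>The norm of an irreducible factor \<open>h\<close> has coefficients in the fixed field and divides a power of
    \<open>f\<close>, so \<open>deg f\<close> divides \<open>|G| deg h\<close>.\<close>
  have degree_ge: "degree f \<le> degree h"
    if h: "h \<in> carrier ?U" "pirreducible\<^bsub>K\<^esub> (carrier K) h" "h divides\<^bsub>?U\<^esub> f" for h
  proof -
    let ?h = "\<lambda>g. map (\<sigma> g) h"
    let ?P = "finprod ?U ?h (carrier G)"
    have h0: "h \<noteq> []" using K.pirreducibleE(1)[OF K.carrier_is_subring h(1,2)] .
    have hU: "?h g \<in> carrier ?U" if "g \<in> carrier G" for g
      using ring_hom_closed[OF \<sigma>X[OF that] h(1)] .
    have P: "?P \<in> carrier ?U" using hU by (intro UP.finprod_closed) auto
    \<comment> \<open>g acts on the conjugates of h by left translation of the index, so it only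
      permutes the factors of the norm.\<close>
    have P_fixed: "map (\<sigma> g) ?P = ?P" if g: "g \<in> carrier G" for g
    proof -
      interpret \<sigma>X: ring_hom_cring ?U ?U "map (\<sigma> g)"
        using \<sigma>X[OF g] UP.is_cring by (simp add: ring_hom_cring_def ring_hom_cring_axioms_def)
      have h_set: "set h \<subseteq> carrier K"
        using h(1) by (auto simp: univ_poly_carrier[symmetric] polynomial_def)
      have "map (\<sigma> g) ?P = finprod ?U (map (\<sigma> g) \<circ> ?h) (carrier G)"
        using hU by (intro \<sigma>X.hom_finprod) auto
      also have "\<dots> = finprod ?U (\<lambda>g'. ?h (g \<otimes>\<^bsub>G\<^esub> g')) (carrier G)"
        using hU g h_set \<sigma>_mult by (intro UP.finprod_cong') auto
      also have "\<dots> = finprod ?U ?h ((\<lambda>g'. g \<otimes>\<^bsub>G\<^esub> g') ` carrier G)"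
        using hU g G.inj_on_cmult by (intro UP.finprod_reindex[symmetric]) auto
      also have "(\<lambda>g'. g \<otimes>\<^bsub>G\<^esub> g') ` carrier G = carrier G"
        using g G.surj_const_mult by simp
      finally show ?thesis .
    qed
    have "\<sigma> g a = a" if g: "g \<in> carrier G" and a: "a \<in> set ?P" for g a
    proof -
      have "map (\<sigma> g) ?P = map (\<lambda>a. a) ?P" unfolding P_fixed[OF g] list.map_ident ..
      then show ?thesis using a unfolding map_eq_conv by blast
    qed
    then have PC: "?P \<in> carrier (univ_poly K fixed_set)"
      using P by (auto simp: univ_poly_carrier[symmetric] polynomial_def)
    have "degree ?P = (\<Sum>g\<in>carrier G. degree (?h g))"
      using K.poly_ring_finprod_degree(2)[OF G hU] h0 by simp
    then have deg_P: "degree ?P = card (carrier G) * degree h" by simp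
    have "?h g divides\<^bsub>?U\<^esub> f" if g: "g \<in> carrier G" for g
    proof -
      obtain r where r: "r \<in> carrier ?U" "f = h \<otimes>\<^bsub>?U\<^esub> r" using h(3) by (auto simp: factor_def)
      then have "f = ?h g \<otimes>\<^bsub>?U\<^esub> map (\<sigma> g) r"
        using ring_hom_mult[OF \<sigma>X[OF g] h(1) r(1)] f_fixed[OF g] by simp
      then show ?thesis using ring_hom_closed[OF \<sigma>X[OF g] r(1)] unfolding factor_def by blast
    qed
    then have "?P divides\<^bsub>?U\<^esub> f [^]\<^bsub>?U\<^esub> card (carrier G)"
      using UP.finprod_divides_pow[OF G hU fK] by simp
    \<comment> \<open>The divisibility was obtained in K[X], but f is known to be irreducible only
      over the fixed field. As both polynomials have their coefficients there, the divisibility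
      descends.\<close>
    then have "?P pdivides\<^bsub>K\<^esub> (f [^]\<^bsub>univ_poly K fixed_set\<^esub> card (carrier G))"
      unfolding pdivides_def K.univ_poly_nat_pow[of fixed_set] .
    moreover have "f [^]\<^bsub>univ_poly K fixed_set\<^esub> card (carrier G) \<in> carrier (univ_poly K fixed_set)"
      using monoid.nat_pow_closed[OF K.univ_poly_is_monoid[OF subfieldE(1)[OF C]] f(1)] .
    ultimately have "degree f dvd degree ?P"
      using K.degree_dvd_of_divides_pow[OF C f PC] K.pdivides_iff_shell[OF C PC] by blast
    then have "degree f dvd degree h"
      unfolding deg_P coprime_dvd_mult_right_iff[OF q(2)] .
    moreover have "degree h \<ge> 1"
      using K.pirreducible_degree[OF K.carrier_is_subfield h(1,2)] .
    ultimately show ?thesis by (auto intro: dvd_imp_le)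
  qed
  show ?thesis
  proof (rule K.pirreducibleI[OF K.carrier_is_subring fK f0])
    have units: "p \<in> Units ?U \<longleftrightarrow> p \<in> carrier ?U \<and> p \<noteq> [] \<and> degree p = 0" for p
      by (rule K.univ_poly_units'[OF K.carrier_is_subfield])
    show "f \<notin> Units ?U" unfolding units using prime_gt_0_nat[OF q(1)] by linarith
    fix a b assume a: "a \<in> carrier ?U" and b: "b \<in> carrier ?U" and ab: "f = a \<otimes>\<^bsub>?U\<^esub> b"
    have a0: "a \<noteq> []" and b0: "b \<noteq> []"
      using f0 ab UP.l_null[OF b] UP.r_null[OF a] by (auto simp: univ_poly_zero)
    have deg: "degree f = degree a + degree b"
      using K.poly_mult_degree_eq[OF K.carrier_is_subring, of a b] a b a0 b0
      unfolding ab univ_poly_mult univ_poly_carrier by simp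
    \<comment> \<open>An irreducible divisor of a also divides f and so has at least the degree of f
      by \<open>degree_ge\<close>. This leaves degree 0 for b.\<close>
    have "b \<in> Units ?U" if not_unit: "a \<notin> Units ?U"
    proof -
      have "a \<in> carrier ?U - {\<zero>\<^bsub>?U\<^esub>}" using a a0 by (simp add: univ_poly_zero)
      then obtain h where h: "h \<in> carrier ?U" "pirreducible\<^bsub>K\<^esub> (carrier K) h" "h divides\<^bsub>?U\<^esub> a"
        using UP.exists_irreducible_divisor[OF _ not_unit] by blast
      have "h divides\<^bsub>?U\<^esub> f"
        unfolding ab using UP.divides_prod_r[OF h(3) h(1) b] .
      then have "degree f \<le> degree h" using degree_ge h by blast
      also have "\<dots> \<le> degree a"
        using K.pdivides_imp_degree_le[OF K.carrier_is_subring h(1) a a0] h(3)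
        by (simp add: pdivides_def)
      finally have "degree b = 0" using deg by linarith
      then show ?thesis unfolding units using b b0 by blast
    qed
    then show "a \<in> Units ?U \<or> b \<in> Units ?U" by blast
  qed
qed

end

section \<open>Failure of quasi-finiteness\<close>

lemma exists_prime_coprime_card:
  assumes "finite A" "A \<noteq> {}"
  obtains q :: nat where "Factorial_Ring.prime q" "coprime q (card A)"
proof -
  obtain q :: nat where q: "Factorial_Ring.prime q" "q > card A" using bigger_prime by blast
  then have "\<not> q dvd card A" using assms by (auto dest: dvd_imp_le simp: card_gt_0_iff)
  then show thesis using that q prime_imp_coprime by blast
qed

context transformal
begin

text \<open>The algebraic closure contains the image of K under \<iota> rather than K. This is the
  action of g on that copy; elsewhere its values carry no meaning.\<close>

definition transported :: "('a \<Rightarrow> 'l) \<Rightarrow> 'g \<Rightarrow> 'l \<Rightarrow> 'l"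
  where "transported \<iota> g = \<iota> \<circ> \<sigma> g \<circ> inv_into (carrier K) \<iota>"

context
  fixes A :: "('l, 'd) ring_scheme" and \<iota> :: "'a \<Rightarrow> 'l"
  assumes A: "field A" and \<iota>: "\<iota> \<in> ring_hom K A"
begin

lemma embedding_image_subfield: "subfield (\<iota> ` carrier K) A"
proof -
  interpret A: field A by (rule A)
  interpret \<iota>: ring_hom_ring K A \<iota>
    using K.ring_axioms A.ring_axioms \<iota> by (rule ring_hom_ringI2)
  show ?thesis using \<iota>.img_is_subfield(2)[OF K.carrier_is_subfield] by simp
qed

lemma embedding_iso: "\<iota> \<in> ring_iso K (A\<lparr>carrier := \<iota> ` carrier K\<rparr>)"
  using \<iota> non_trivial_field_hom_is_inj[OF \<iota> K.field_axioms A]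
  by (auto simp: ring_iso_def ring_hom_def bij_betw_def)

lemma transported_apply: "a \<in> carrier K \<Longrightarrow> transported \<iota> g (\<iota> a) = \<iota> (\<sigma> g a)"
  using non_trivial_field_hom_is_inj[OF \<iota> K.field_axioms A] by (simp add: transported_def)

lemma transported_iso:
  assumes g: "g \<in> carrier G"
  shows "transported \<iota> g \<in> ring_iso (A\<lparr>carrier := \<iota> ` carrier K\<rparr>) (A\<lparr>carrier := \<iota> ` carrier K\<rparr>)"
proof -
  have "\<sigma> g \<in> ring_iso K K" using \<sigma>_ring_hom[OF g] \<sigma>_bij[OF g] by (simp add: ring_iso_def)
  then show ?thesis
    unfolding transported_def
    using ring_iso_set_trans[OF ring_iso_set_trans[OF
        ring_iso_set_sym[OF K.ring_axioms embedding_iso]] embedding_iso]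
    by (simp add: comp_assoc)
qed

end

lemma not_quasi_finite:
  assumes G: "finite (carrier G)" and TCF: "TCF_model G K \<sigma>"
  shows "\<not> K.quasi_finite"
proof
  assume qf: "K.quasi_finite"
  obtain q where q: "Factorial_Ring.prime q" "coprime q (card (carrier G))"
    using exists_prime_coprime_card[OF G] G.one_closed by blast
  let ?A = "K.alg_closure" and ?\<iota> = "K.indexed_const :: 'a \<Rightarrow> ('a list \<times> nat) multiset \<Rightarrow> 'a"
  let ?F = "?\<iota> ` carrier K"
  interpret A: algebraic_closure ?A ?F by (rule K.alg_closureE(1))
  note \<iota> = K.alg_closureE(2)
  note F = embedding_image_subfield[OF A.field_axioms \<iota>]
  have "\<exists>!E. K.extension_of_degree q E"
    using qf prime_gt_0_nat[OF q(1)] unfolding K.quasi_finite_def by blast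
  then obtain E where E: "K.extension_of_degree q E"
    and unique: "\<And>E'. K.extension_of_degree q E' \<Longrightarrow> E' = E"
    by (rule ex1E) blast
  have E': "subfield E ?A" "?F \<subseteq> E" "A.dimension q ?F E"
    using E by (simp_all add: K.extension_of_degree_def)
  let ?s = "transported ?\<iota>"
  obtain T where T: "T \<in> hom G (ring_aut_group (?A\<lparr>carrier := E\<rparr>))"
    and Ts: "\<And>g k. g \<in> carrier G \<Longrightarrow> k \<in> ?F \<Longrightarrow> T g k = ?s g k"
  proof (rule A.action_on_unique_extension[OF G.is_group G F _ _ _ q E'])
    show "A.splitted p" if "p \<in> carrier (univ_poly ?A ?F)" for p
      using A.roots_over_subfield that .
    show "?s g \<in> ring_iso (?A\<lparr>carrier := ?F\<rparr>) (?A\<lparr>carrier := ?F\<rparr>)" if "g \<in> carrier G" for g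
      using transported_iso[OF A.field_axioms \<iota> that] .
    show "?s (g \<otimes>\<^bsub>G\<^esub> g') k = ?s g (?s g' k)"
      if "g \<in> carrier G" "g' \<in> carrier G" "k \<in> ?F" for g g' k
      using that by (auto simp: transported_apply[OF A.field_axioms \<iota>] \<sigma>_mult \<sigma>_closed)
    show "E'' = E" if "subfield E'' ?A" "?F \<subseteq> E''" "A.dimension q ?F E''" for E''
      using unique that by (simp add: K.extension_of_degree_def)
  qed blast
  have "?F \<noteq> E"
    using A.dimension_is_inj[OF F, of 1 ?F q] A.dimension_one[OF F] q(1) E'(3) by auto
  then obtain x where x: "x \<in> E" "x \<notin> ?F" using E'(2) by blast
  have xA: "x \<in> carrier ?A" using x(1) subfieldE(3)[OF E'(1)] by blast
  note Fx = A.simple_extension_of_prime_degree[OF F E'(1,2) q(1) E'(3) x]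
  note Irr = A.IrrE[OF F xA Fx(2)]
  interpret E: ring "?A\<lparr>carrier := E\<rparr>" using A.subring_is_ring[OF subfieldE(1)[OF E'(1)]] .
  have TH: "T g \<in> carrier (ring_aut_group (?A\<lparr>carrier := E\<rparr>))" if "g \<in> carrier G" for g
    using T that by (auto simp: hom_def)
  \<comment> \<open>The minimal polynomial of x has degree q, while the action T on E forces it to
    be linear.\<close>
  have "degree (A.Irr ?F x) = 1"
  proof (rule no_transformal_extension[OF TCF A.field_axioms \<iota> E'(1,2) _ _ x(1) _ _ Irr(1,2,4)])
    show "T g \<in> ring_hom (?A\<lparr>carrier := E\<rparr>) (?A\<lparr>carrier := E\<rparr>)" if "g \<in> carrier G" for g
      using TH[OF that] by (simp add: E.mem_ring_aut_group)
    show "T g (?\<iota> a) = ?\<iota> (\<sigma> g a)" if "g \<in> carrier G" "a \<in> carrier K" for g a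
      using Ts that transported_apply[OF A.field_axioms \<iota>] by simp
    show "T (g \<otimes>\<^bsub>G\<^esub> g') x = T g (T g' x)" if "g \<in> carrier G" "g' \<in> carrier G" for g g'
      using T that E.ring_aut_group_apply[OF TH TH, of g g' x] x(1) by (simp add: hom_mult)
    have "T \<one>\<^bsub>G\<^esub> = \<one>\<^bsub>ring_aut_group (?A\<lparr>carrier := E\<rparr>)\<^esub>"
      using hom_one[OF T G.is_group E.ring_aut_group_is_group] .
    then show "T \<one>\<^bsub>G\<^esub> x = x" using E.ring_aut_group_one[of x] x(1) by simp
  qed
  then have "q = 1" using Fx(3) by simp
  then show False using q(1) by simp
qed

text \<open>Because G fixes the coefficients of f, each \<sigma>_g extends to K(x), for a root x of
  f, in such a way that x is fixed. The action law at x then holds trivially and there is no factor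
  set to remove.\<close>

lemma no_fixed_irreducible:
  assumes TCF: "TCF_model G K \<sigma>"
    and f: "f \<in> carrier (poly_ring K)" "pirreducible\<^bsub>K\<^esub> (carrier K) f" "set f \<subseteq> fixed_set"
  shows "degree f = 1"
proof -
  let ?A = "K.alg_closure" and ?\<iota> = "K.indexed_const :: 'a \<Rightarrow> ('a list \<times> nat) multiset \<Rightarrow> 'a"
  let ?F = "?\<iota> ` carrier K"
  interpret A: algebraic_closure ?A ?F by (rule K.alg_closureE(1))
  note \<iota> = K.alg_closureE(2)
  note F = embedding_image_subfield[OF A.field_axioms \<iota>]
  have Ffield: "field (?A\<lparr>carrier := ?F\<rparr>)" using A.subfield_iff(2)[OF F] .
  have FX: "poly_ring (?A\<lparr>carrier := ?F\<rparr>) = univ_poly ?A ?F"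
    using A.univ_poly_consistent[OF subfieldE(1)[OF F]] by simp
  note iso = embedding_iso[OF A.field_axioms \<iota>]
  then have \<iota>_hom: "?\<iota> \<in> ring_hom K (?A\<lparr>carrier := ?F\<rparr>)" by (simp add: ring_iso_def)
  define p where "p = map ?\<iota> f"
  have p: "p \<in> carrier (univ_poly ?A ?F)" "pirreducible\<^bsub>?A\<^esub> ?F p"
    using ring_hom_closed[OF map_poly_hom[OF K.field_axioms Ffield \<iota>_hom] f(1)]
      pirreducible_map[OF K.field_axioms Ffield iso f(1,2)]
    unfolding FX p_def by simp_all
  have pA: "p \<in> carrier (poly_ring ?A)"
    using A.carrier_polynomial_shell[OF subfieldE(1)[OF F] p(1)] .
  have "size (A.roots p) = degree p" using A.roots_over_subfield[OF p(1)] by (simp add: A.splitted_def)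
  moreover have "degree p \<ge> 1" using A.pirreducible_degree[OF F p] .
  ultimately have "A.roots p \<noteq> {#}" by auto
  then obtain x where "x \<in># A.roots p" by blast
  then have x: "x \<in> carrier ?A" "A.eval p x = \<zero>\<^bsub>?A\<^esub>"
    using A.roots_mem_iff_is_root[OF pA] by (auto simp: A.is_root_def)
  let ?E = "A.simple_extension ?F x"
  let ?s = "transported ?\<iota>"
  have s_p: "map (?s g) p = p" if "g \<in> carrier G" for g
    using that f(3) by (auto simp: p_def transported_apply[OF A.field_axioms \<iota>] subset_iff)
  have s_hom: "?s g \<in> ring_hom (?A\<lparr>carrier := ?F\<rparr>) (?A\<lparr>carrier := ?F\<rparr>)" if "g \<in> carrier G" for g
    using transported_iso[OF A.field_axioms \<iota> that] by (simp add: ring_iso_def)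
  have E_img: "?E = (\<lambda>r. A.eval r x) ` carrier (univ_poly ?A ?F)"
    using A.simple_extension_as_eval_img[OF subfieldE(3)[OF F] x(1)] .
  \<comment> \<open>The extension takes x to itself, which is possible since g fixes p. Its image
    consists of values of polynomials at x and so stays in K(x).\<close>
  have "\<exists>t. t \<in> ring_hom (?A\<lparr>carrier := ?E\<rparr>) (?A\<lparr>carrier := ?E\<rparr>) \<and>
      (\<forall>k\<in>?F. t k = ?s g k) \<and> t x = x" if g: "g \<in> carrier G" for g
  proof -
    obtain t where t: "t \<in> ring_hom (?A\<lparr>carrier := ?E\<rparr>) ?A" "\<And>k. k \<in> ?F \<Longrightarrow> t k = ?s g k" "t x = x"
      "\<And>r. r \<in> carrier (univ_poly ?A ?F) \<Longrightarrow> t (A.eval r x) = A.eval (map (?s g) r) x"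
      using A.extend_hom_simple_extension[OF F s_hom[OF g] p x x(1)] x(2) s_p[OF g] by metis
    have "t u \<in> ?E" if "u \<in> ?E" for u
    proof -
      obtain r where r: "r \<in> carrier (univ_poly ?A ?F)" "u = A.eval r x" using \<open>u \<in> ?E\<close> E_img by blast
      have "map (?s g) r \<in> carrier (univ_poly ?A ?F)"
        using ring_hom_closed[OF map_poly_hom[OF Ffield Ffield s_hom[OF g]]] r(1) unfolding FX by blast
      then show ?thesis using t(4)[OF r(1)] r(2) E_img by blast
    qed
    then have "t \<in> ring_hom (?A\<lparr>carrier := ?E\<rparr>) (?A\<lparr>carrier := ?E\<rparr>)"
      using t(1) by (auto simp: ring_hom_def)
    then show ?thesis using t(2,3) by blast
  qed
  then obtain T where T: "\<And>g. g \<in> carrier G \<Longrightarrow> T g \<in> ring_hom (?A\<lparr>carrier := ?E\<rparr>) (?A\<lparr>carrier := ?E\<rparr>)"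
    and TF: "\<And>g k. g \<in> carrier G \<Longrightarrow> k \<in> ?F \<Longrightarrow> T g k = ?s g k"
    and Tx: "\<And>g. g \<in> carrier G \<Longrightarrow> T g x = x" by metis
  have "degree p = 1"
  proof (rule no_transformal_extension[OF TCF A.field_axioms \<iota> _ _ T _ _ _ _ p x(2)])
    show "subfield ?E ?A" using A.dimension_simple_extension'(2)[OF F p x] .
    show "?F \<subseteq> ?E" using A.simple_extension_incl[OF subfieldE(3)[OF F] x(1)] .
    show "x \<in> ?E" using A.simple_extension_mem[OF subfieldE(1)[OF F] x(1)] .
    show "T g (?\<iota> a) = ?\<iota> (\<sigma> g a)" if "g \<in> carrier G" "a \<in> carrier K" for g a
      using TF that transported_apply[OF A.field_axioms \<iota>] by simp
  qed (simp_all add: Tx)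
  then show ?thesis by (simp add: p_def)
qed

lemma fixed_field_is_field: "field (fixed_field G K \<sigma>)"
  unfolding fixed_field_def by (rule K.subfield_iff(2)[OF fixed_set_subfield])

text \<open>The algebraic closures of C and of K are separate constructions, so the extension of C
  is not compared with K as a field. Only the minimal polynomial of a generator is used: its
  coefficients are carried back to C, which is a subset of K, and the result is viewed over
  K.\<close>

lemma fixed_field_not_quasi_finite:
  assumes G: "finite (carrier G)" and TCF: "TCF_model G K \<sigma>"
  shows "\<not> field.quasi_finite (fixed_field G K \<sigma>)"
proof
  assume qf: "field.quasi_finite (fixed_field G K \<sigma>)"
  define C where "C = fixed_field G K \<sigma>"
  interpret C: field C unfolding C_def by (rule fixed_field_is_field)
  obtain q where q: "Factorial_Ring.prime q" "coprime q (card (carrier G))"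
    using exists_prime_coprime_card[OF G] G.one_closed by blast
  let ?A = "C.alg_closure" and ?\<iota> = "C.indexed_const :: 'a \<Rightarrow> ('a list \<times> nat) multiset \<Rightarrow> 'a"
  let ?F = "?\<iota> ` carrier C"
  interpret A: algebraic_closure ?A ?F by (rule C.alg_closureE(1))
  note \<iota> = C.alg_closureE(2)
  interpret \<iota>: ring_hom_ring C ?A ?\<iota>
    using C.ring_axioms A.ring_axioms \<iota> by (rule ring_hom_ringI2)
  have F: "subfield ?F ?A"
    using \<iota>.img_is_subfield(2)[OF C.carrier_is_subfield] by simp
  have Ffield: "field (?A\<lparr>carrier := ?F\<rparr>)" using A.subfield_iff(2)[OF F] .
  have iso: "?\<iota> \<in> ring_iso C (?A\<lparr>carrier := ?F\<rparr>)"
    using \<iota> non_trivial_field_hom_is_inj[OF \<iota> C.field_axioms A.field_axioms]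
    by (auto simp: ring_iso_def ring_hom_def bij_betw_def)
  obtain E where "C.extension_of_degree q E"
    using qf prime_gt_0_nat[OF q(1)] unfolding C_def[symmetric] C.quasi_finite_def by blast
  then have E: "subfield E ?A" "?F \<subseteq> E" "A.dimension q ?F E"
    by (simp_all add: C.extension_of_degree_def)
  have "?F \<noteq> E"
    using A.dimension_is_inj[OF F, of 1 ?F q] A.dimension_one[OF F] q(1) E(3) by auto
  then obtain x where x: "x \<in> E" "x \<notin> ?F" using E(2) by blast
  have xA: "x \<in> carrier ?A" using x(1) subfieldE(3)[OF E(1)] by blast
  note Fx = A.simple_extension_of_prime_degree[OF F E(1,2) q(1) E(3) x]
  note Irr = A.IrrE[OF F xA Fx(2)]
  have FX: "poly_ring (?A\<lparr>carrier := ?F\<rparr>) = univ_poly ?A ?F"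
    using A.univ_poly_consistent[OF subfieldE(1)[OF F]] by simp
  let ?j = "inv_into (carrier C) ?\<iota>"
  have j: "?j \<in> ring_iso (?A\<lparr>carrier := ?F\<rparr>) C" using ring_iso_set_sym[OF C.ring_axioms iso] .
  then have j_hom: "?j \<in> ring_hom (?A\<lparr>carrier := ?F\<rparr>) C" by (simp add: ring_iso_def)
  define f where "f = map ?j (A.Irr ?F x)"
  have CX: "poly_ring C = univ_poly K fixed_set"
    using K.univ_poly_consistent[OF subfieldE(1)[OF fixed_set_subfield]]
    by (simp add: C_def fixed_field_def)
  have f: "f \<in> carrier (univ_poly K fixed_set)" "pirreducible\<^bsub>K\<^esub> fixed_set f"
    using ring_hom_closed[OF map_poly_hom[OF Ffield C.field_axioms j_hom]]
      pirreducible_map[OF Ffield C.field_axioms j] Irr(1,2)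
    unfolding FX CX f_def by simp_all
  have deg: "degree f = q" using Fx(3) by (simp add: f_def)
  have "pirreducible\<^bsub>K\<^esub> (carrier K) f"
    using pirreducible_of_fixed_set[OF G f] q deg by simp
  moreover have "f \<in> carrier (poly_ring K)"
    using K.carrier_polynomial_shell[OF subfieldE(1)[OF fixed_set_subfield] f(1)] .
  moreover have "set f \<subseteq> fixed_set"
    using f(1) unfolding univ_poly_carrier[symmetric] polynomial_def by auto
  ultimately have "degree f = 1" using no_fixed_irreducible[OF TCF] by blast
  then have "q = 1" using deg by simp
  then show False using q(1) by simp
qed

end

theorem corollary3p36:
  fixes G :: "('g, 'b) monoid_scheme"
    and K :: "('a, 'c) ring_scheme"
    and \<sigma> :: "'g \<Rightarrow> 'a \<Rightarrow> 'a"
  assumes "group G" and "finite (carrier G)"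
    and "TCF_model G K \<sigma>"
  shows "\<not> field.quasi_finite K \<and> \<not> field.quasi_finite (fixed_field G K \<sigma>) \<and>
         \<not> field.pseudo_finite K \<and> \<not> field.pseudo_finite (fixed_field G K \<sigma>)"
proof -
  have "field K" "\<sigma> \<in> hom G (ring_aut_group K)"
    using assms(3) by (simp_all add: TCF_model_def transformal_field_def)
  then interpret transformal G K \<sigma>
    using assms(1) by (simp add: transformal_def transformal_axioms_def)
  show ?thesis
    using not_quasi_finite[OF assms(2,3)] fixed_field_not_quasi_finite[OF assms(2,3)]
      K.pseudo_finite_def field.pseudo_finite_def[OF fixed_field_is_field] by blast
qed

end
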